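(* Let $F$ be any probability distribution on $[0,\infty)$, and consider first-passage percolation on $\mathbb{Z}^2$ with i.i.d. edge weights distributed according to $F$. For $q\in(0,1)$ let $t_q:=\inf\{t\ge 0: F(t)\ge q\}$, where $F(t)$ denotes the distribution function of $F$. Then the time constant $\mu$ satisfies $$\tfrac{1}{100}\,t_{1/3}\;\le\;\mu\;\le\;2\,t_{2/3}.$$
   Context: First-passage percolation on the square lattice $\mathbb{Z}^2$ (with nearest-neighbour edges): weights $\omega_e$ are assigned independently to the edges $e$, each with distribution $F$ on $[0,\infty)$. For $x,y\in\mathbb{Z}^2$ define $T(x,y):=\inf\{\sum_{e\in\pi}\omega_e : \pi \text{ is a self-avoiding path connecting } x \text{ to } y\}$. The time constant $\mu$ is the limit $\mu:=\lim_{n\to\infty}\frac1n T\big((0,0),(n,0)\big)$; this limit exists in probability (as a deterministic constant in $[0,\infty)$) for every weight distribution $F$, and almost surely when $\mathbb{E}[Y]<\infty$, where $Y$ is the minimum of four independent $F$-distributed variables. *)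

theory Defs
  imports "HOL-Probability.Probability"
begin

type_synonym vertex = "int \<times> int"

definition adj :: "vertex \<Rightarrow> vertex \<Rightarrow> bool" where
  "adj x y \<longleftrightarrow> \<bar>fst x - fst y\<bar> + \<bar>snd x - snd y\<bar> = 1"

definition lattice_edges :: "vertex set set" where
  "lattice_edges = {{x, y} | x y. adj x y}"

definition sa_path :: "vertex list \<Rightarrow> vertex \<Rightarrow> vertex \<Rightarrow> bool" where
  "sa_path p x y \<longleftrightarrow> p \<noteq> [] \<and> hd p = x \<and> last p = y \<and> distinct p \<and>
     (\<forall>i. Suc i < length p \<longrightarrow> adj (p ! i) (p ! Suc i))"

definition path_weight :: "(vertex set \<Rightarrow> real) \<Rightarrow> vertex list \<Rightarrow> real" where
  "path_weight w p = (\<Sum>i < length p - 1. w {p ! i, p ! Suc i})"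

definition passage_time :: "(vertex set \<Rightarrow> real) \<Rightarrow> vertex \<Rightarrow> vertex \<Rightarrow> real" where
  "passage_time w x y = Inf (path_weight w ` {p. sa_path p x y})"

definition quantile_t :: "real measure \<Rightarrow> real \<Rightarrow> real" where
  "quantile_t F q = Inf {t. t \<ge> 0 \<and> measure F {..t} \<ge> q}"

end

theory Submission
  imports Defs
begin

text \<open>
  Lower bound. Call an edge cheap if its weight is at most \<open>s < t\<^sub>1\<^sub>/\<^sub>3\<close>; this has probability at most \<open>1/3\<close>.
  Self-avoiding paths neither backtrack nor run around a unit square, and this alone makes
  their number grow at a rate below \<open>3\<close>, even when steps towards the target are favoured
  by a factor \<open>11/10\<close>. Summing \<open>1000\<^sup>-\<^sup>c\<close> over all paths to \<open>(100 k, 0)\<close>, where \<open>c\<close> is the number of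
  expensive edges, shows that with high probability every path has at least \<open>k\<close> of them.

  Upper bound. Call an edge open if its weight is at most \<open>t\<close>, where this has probability
  at least \<open>2/3\<close>. By Liggett's theorem oriented percolation survives: the probability that a
  certain stationary renewal process avoids the occupied set is a supermartingale, started at \<open>1/2\<close>.
  Two open oriented paths, one from \<open>(0, 0)\<close> staying low and the mirror image of such a path
  from \<open>(2 m, 0)\<close>, cross and yield an open path with at most \<open>4 m\<close> edges; by symmetry and
  Harris' inequality both exist with probability at least \<open>1/16\<close>, which is enough because
  \<open>T n / n\<close> converges in probability.

  For Liggett's inequality, the renewal process has gap tails \<open>C\<^sub>k / 4\<^sup>k\<close>, the moments of a measure
  on \<open>[0, 1]\<close>, so that avoidance probabilities become integrals. An operator \<open>Q\<close> intertwines one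
  percolation step with multiplication by \<open>x\<close> on full intervals, where equality holds, and commutes with
  passing an empty site up to a rank-one error of definite sign.
\<close>

section \<open>The arcsine and Catalan functionals\<close>

text \<open>Both thresholds are borderline for the naive arguments. Non-backtracking paths grow at
  rate exactly 3, and \<open>3 * (1/3) = 1\<close> leaves no decay; excluding unit squares gains
  just enough, \<open>59/20 * (334/1000) < 1\<close>, to pay for the drift and for the price put on
  expensive edges. On the other side, the renewal process is tuned to closing probability 1/3: for a
  full interval of occupied sites one percolation step conserves the mean avoidance probability. But
  the occupied set has holes, and the step cannot be followed through them exactly. The work goes
  into the error made at one hole, which is a product of a number depending on the sites on one side
  and a number depending on the sites on the other; both must be shown nonnegative. The crossing
  probability only has to stay away from 0: as the limit is deterministic, an event of probability
  at least 1/16 at every scale forces the bound. A crossing over distance \<open>2 * m\<close> uses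
  up to \<open>4 * m\<close> edges, whence the factor 2.\<close>

definition arcsine_mean :: "(real \<Rightarrow> real) \<Rightarrow> real" where
  "arcsine_mean \<phi> = 2 / pi * integral {0..pi/2} (\<lambda>t. \<phi> ((cos t)\<^sup>2))"

text \<open>With \<open>x = (cos t)^2\<close>, \<open>arcsine_mean\<close> is the mean under the
  arcsine law, of density \<open>1 / (pi * sqrt (x * (1 - x)))\<close>. Weighting by
  \<open>2 * (1 - x)\<close> gives the density \<open>2 / pi * sqrt ((1 - x) / x)\<close>, whose
  moments are the numbers \<open>cat k\<close> below. The trigonometric form avoids the singular
  endpoints.\<close>

definition catalan_mean :: "(real \<Rightarrow> real) \<Rightarrow> real" where
  "catalan_mean \<phi> = 2 * arcsine_mean (\<lambda>x. (1 - x) * \<phi> x)"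

abbreviation cont01 :: "(real \<Rightarrow> real) \<Rightarrow> bool" where
  "cont01 \<phi> \<equiv> continuous_on {0..1} \<phi>"

lemma cos_square_in_01: "(cos (t::real))\<^sup>2 \<in> {0..1}"
  by (simp add: abs_square_le_1)

lemma cont01_integrable:
  assumes "cont01 \<phi>"
  shows "(\<lambda>t. \<phi> ((cos t)\<^sup>2)) integrable_on {0..pi/2}"
proof (rule integrable_continuous_real)
  have "continuous_on {0..pi/2} (\<phi> \<circ> (\<lambda>t. (cos t)\<^sup>2))"
    by (rule continuous_on_compose[OF _ continuous_on_subset[OF assms]])
       (use cos_square_in_01 in \<open>auto intro!: continuous_intros\<close>)
  then show "continuous_on {0..pi/2} (\<lambda>t. \<phi> ((cos t)\<^sup>2))" by (simp add: o_def)
qed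

lemma arcsine_mean_add:
  "cont01 \<phi> \<Longrightarrow> cont01 \<psi> \<Longrightarrow> arcsine_mean (\<lambda>x. \<phi> x + \<psi> x) = arcsine_mean \<phi> + arcsine_mean \<psi>"
  unfolding arcsine_mean_def
  by (subst integral_add[OF cont01_integrable cont01_integrable]) (auto simp: algebra_simps)

lemma arcsine_mean_cmult: "arcsine_mean (\<lambda>x. c * \<phi> x) = c * arcsine_mean \<phi>"
  unfolding arcsine_mean_def by simp

lemma arcsine_mean_diff:
  "cont01 \<phi> \<Longrightarrow> cont01 \<psi> \<Longrightarrow> arcsine_mean (\<lambda>x. \<phi> x - \<psi> x) = arcsine_mean \<phi> - arcsine_mean \<psi>"
  using arcsine_mean_add[of \<phi> "\<lambda>x. (-1) * \<psi> x"] arcsine_mean_cmult[of "-1" \<psi>]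
  by (simp add: continuous_on_minus)

lemma arcsine_mean_mono:
  assumes "cont01 \<phi>" "cont01 \<psi>" "\<And>x. x \<in> {0..1} \<Longrightarrow> \<phi> x \<le> \<psi> x"
  shows "arcsine_mean \<phi> \<le> arcsine_mean \<psi>"
proof -
  have "integral {0..pi/2} (\<lambda>t. \<phi> ((cos t)\<^sup>2)) \<le> integral {0..pi/2} (\<lambda>t. \<psi> ((cos t)\<^sup>2))"
    by (intro integral_le cont01_integrable assms cos_square_in_01)
  then show ?thesis unfolding arcsine_mean_def by (intro mult_left_mono) auto
qed

lemma arcsine_mean_cong:
  "(\<And>x. x \<in> {0..1} \<Longrightarrow> \<phi> x = \<psi> x) \<Longrightarrow> arcsine_mean \<phi> = arcsine_mean \<psi>"
  unfolding arcsine_mean_def using cos_square_in_01 by simp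

lemma arcsine_mean_const: "arcsine_mean (\<lambda>_. c) = c"
  unfolding arcsine_mean_def by simp

lemma catalan_mean_add:
  "cont01 \<phi> \<Longrightarrow> cont01 \<psi> \<Longrightarrow> catalan_mean (\<lambda>x. \<phi> x + \<psi> x) = catalan_mean \<phi> + catalan_mean \<psi>"
  unfolding catalan_mean_def distrib_left
  by (subst arcsine_mean_add) (auto intro!: continuous_intros)

lemma catalan_mean_cmult: "catalan_mean (\<lambda>x. c * \<phi> x) = c * catalan_mean \<phi>"
  unfolding catalan_mean_def
  using arcsine_mean_cmult[of c "\<lambda>x. (1 - x) * \<phi> x"] by (simp add: algebra_simps)

lemma catalan_mean_diff:
  "cont01 \<phi> \<Longrightarrow> cont01 \<psi> \<Longrightarrow> catalan_mean (\<lambda>x. \<phi> x - \<psi> x) = catalan_mean \<phi> - catalan_mean \<psi>"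
  using catalan_mean_add[of \<phi> "\<lambda>x. (-1) * \<psi> x"] catalan_mean_cmult[of "-1" \<psi>]
  by (simp add: continuous_on_minus)

lemma catalan_mean_mono:
  assumes "cont01 \<phi>" "cont01 \<psi>" "\<And>x. x \<in> {0..1} \<Longrightarrow> \<phi> x \<le> \<psi> x"
  shows "catalan_mean \<phi> \<le> catalan_mean \<psi>"
proof -
  have "arcsine_mean (\<lambda>x. (1 - x) * \<phi> x) \<le> arcsine_mean (\<lambda>x. (1 - x) * \<psi> x)"
    by (rule arcsine_mean_mono) (use assms in \<open>auto intro!: continuous_intros mult_left_mono\<close>)
  then show ?thesis unfolding catalan_mean_def by simp
qed

lemma catalan_mean_cong:
  "(\<And>x. x \<in> {0..1} \<Longrightarrow> \<phi> x = \<psi> x) \<Longrightarrow> catalan_mean \<phi> = catalan_mean \<psi>"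
  unfolding catalan_mean_def by (auto intro: arcsine_mean_cong)

lemma catalan_mean_nonneg:
  "cont01 \<phi> \<Longrightarrow> (\<And>x. x \<in> {0..1} \<Longrightarrow> 0 \<le> \<phi> x) \<Longrightarrow> 0 \<le> catalan_mean \<phi>"
  using catalan_mean_mono[of "\<lambda>_. 0" \<phi>] by (simp add: catalan_mean_def arcsine_mean_const)

lemma arcsine_mean_eqI:
  assumes "\<And>t. t \<in> {0..pi/2} \<Longrightarrow> (g has_real_derivative \<phi> ((cos t)\<^sup>2)) (at t)"
  shows "arcsine_mean \<phi> = 2 / pi * (g (pi/2) - g 0)"
proof -
  have "((\<lambda>t. \<phi> ((cos t)\<^sup>2)) has_integral (g (pi/2) - g 0)) {0..pi/2}"
    by (rule fundamental_theorem_of_calculus)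
       (use assms in \<open>auto simp: has_real_derivative_iff_has_vector_derivative[symmetric]
                          intro: has_field_derivative_at_within\<close>)
  then show ?thesis unfolding arcsine_mean_def by (simp add: integral_unique)
qed

text \<open>Integration by parts: \<open>cos t ^ (2*k+1) * sin t\<close> vanishes at both ends of
  \<open>{0..pi/2}\<close>.\<close>

lemma arcsine_moment_Suc:
  "arcsine_mean (\<lambda>x. x ^ Suc k) = (2*k+1) / (2*k+2) * arcsine_mean (\<lambda>x. x ^ k)"
proof -
  let ?\<phi> = "\<lambda>x::real. (2*k+2) * x ^ Suc k + (- (2*k+1)) * x ^ k"
  let ?g = "\<lambda>t::real. cos t ^ (2*k+1) * sin t"
  have "(?g has_real_derivative ?\<phi> ((cos t)\<^sup>2)) (at t)" for t
  proof -
    have "(?g has_real_derivative cos t ^ (2*k+1) * cos t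
            + (real (2*k+1) * (cos t ^ (2*k) * (- sin t))) * sin t) (at t)"
    proof -
      have "((\<lambda>t. cos t ^ (2*k+1)) has_real_derivative real (2*k+1) * (cos t ^ (2*k) * (- sin t))) (at t)"
        using DERIV_power[OF DERIV_cos[of t], of "2*k+1"] by (simp add: mult_ac)
      from DERIV_mult[OF this DERIV_sin[of t]] show ?thesis by (simp add: algebra_simps)
    qed
    moreover have "cos t ^ (2*k+1) * cos t + (real (2*k+1) * (cos t ^ (2*k) * (- sin t))) * sin t
        = ?\<phi> ((cos t)\<^sup>2)"
    proof -
      have s: "sin t * sin t = 1 - (cos t)\<^sup>2" using sin_squared_eq[of t] by (simp add: power2_eq_square)
      have "cos t ^ (2*k+1) * cos t + (real (2*k+1) * (cos t ^ (2*k) * (- sin t))) * sin t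
        = cos t ^ (2*k) * ((cos t)\<^sup>2 - (2*k+1) * (sin t * sin t))"
        by (simp add: power2_eq_square algebra_simps)
      also have "\<dots> = ((cos t)\<^sup>2) ^ k * ((2*k+2) * (cos t)\<^sup>2 - (2*k+1))"
        unfolding s power_mult by (simp add: algebra_simps)
      finally show ?thesis by (simp add: algebra_simps)
    qed
    ultimately show ?thesis by simp
  qed
  then have "arcsine_mean ?\<phi> = 2 / pi * (?g (pi/2) - ?g 0)" by (intro arcsine_mean_eqI)
  then have "arcsine_mean ?\<phi> = 0" by simp
  then have "(2*k+2) * arcsine_mean (\<lambda>x. x ^ Suc k) + (- (2*k+1)) * arcsine_mean (\<lambda>x. x ^ k) = 0"
    by (subst (asm) arcsine_mean_add) (auto intro!: continuous_intros simp: arcsine_mean_cmult simp del: power_Suc)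
  then show ?thesis by (simp add: field_simps)
qed

text \<open>\<open>cat k = C\<^sub>k / 4\<^sup>k\<close> with the Catalan numbers \<open>C\<^sub>k\<close> is the probability that a gap of the renewal
  process exceeds \<open>k\<close>, and \<open>gap k\<close> the probability that it equals \<open>k + 1\<close>.\<close>

primrec cat :: "nat \<Rightarrow> real" where
  "cat 0 = 1"
| "cat (Suc k) = cat k * (2*k+1) / (2*k+4)"

definition gap :: "nat \<Rightarrow> real" where "gap k = cat k - cat (Suc k)"

lemma arcsine_moment: "arcsine_mean (\<lambda>x. x ^ k) = (k + 1) * cat k"
proof (induction k)
  case 0 then show ?case by (simp add: arcsine_mean_const)
next
  case (Suc k)
  have "arcsine_mean (\<lambda>x. x ^ Suc k) = (2*k+1) / (2*k+2) * ((k+1) * cat k)"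
    unfolding arcsine_moment_Suc[of k] Suc by (simp add: algebra_simps)
  also have "\<dots> = (real (Suc k) + 1) * cat (Suc k)"
    by (simp add: divide_simps) (simp add: algebra_simps)
  finally show ?case .
qed

lemma catalan_moment: "catalan_mean (\<lambda>x. x ^ k) = cat k"
proof -
  have "arcsine_mean (\<lambda>x. (1 - x) * x ^ k) = arcsine_mean (\<lambda>x. x ^ k - x ^ Suc k)"
    by (rule arcsine_mean_cong) (simp add: algebra_simps)
  also have "\<dots> = (k+1) * cat k - (Suc k + 1) * cat (Suc k)"
    using arcsine_moment[of k] arcsine_moment[of "Suc k"]
    by (subst arcsine_mean_diff) (auto intro!: continuous_intros simp del: power_Suc cat.simps)
  also have "\<dots> = cat k / 2" by (simp add: divide_simps) (simp add: algebra_simps)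
  finally show ?thesis unfolding catalan_mean_def by simp
qed

lemma catalan_mean_const: "catalan_mean (\<lambda>_. c) = c"
  using catalan_moment[of 0] catalan_mean_cmult[of c "\<lambda>_. 1"] by simp

lemma catalan_gap: "catalan_mean (\<lambda>x. (1 - x) * x ^ k) = gap k"
proof -
  have "catalan_mean (\<lambda>x. (1 - x) * x ^ k) = catalan_mean (\<lambda>x. x ^ k - x ^ Suc k)"
    by (rule catalan_mean_cong) (simp add: algebra_simps)
  then show ?thesis
    by (subst (asm) catalan_mean_diff) (auto intro!: continuous_intros simp: catalan_moment gap_def simp del: power_Suc cat.simps)
qed

text \<open>The usual antiderivative \<open>arctan (tan t / 2) / 2\<close> breaks down at
  \<open>pi/2\<close>. The subtraction formula for \<open>arctan\<close> turns it into
  \<open>?g\<close>, which is smooth on the whole interval.\<close>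

lemma arcsine_mean_resolvent: "arcsine_mean (\<lambda>x. 1 / (1 + 3 * x)) = 1 / 2"
proof -
  let ?u = "\<lambda>t::real. cos t * sin t / (1 + (cos t)\<^sup>2)"
  let ?g = "\<lambda>t::real. (t - arctan (?u t)) / 2"
  have "(?g has_real_derivative 1 / (1 + 3 * (cos t)\<^sup>2)) (at t)" for t
  proof -
    have pos: "1 + (cos t)\<^sup>2 > 0" using zero_le_power2[of "cos t"] by linarith
    define c where "c = (cos t)\<^sup>2"
    have s: "sin t * sin t = 1 - c" "(sin t)\<^sup>2 = 1 - c" using sin_squared_eq[of t] by (simp_all add: c_def power2_eq_square)
    have cc: "cos t * cos t = c" by (simp add: c_def power2_eq_square)
    have c0: "c \<ge> 0" by (simp add: c_def)
    have du: "(?u has_real_derivative (3 * c - 1) / (1 + c)\<^sup>2) (at t)"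
    proof -
      have "(?u has_real_derivative ((cos t * cos t + (- sin t) * sin t) * (1 + (cos t)\<^sup>2)
              - (cos t * sin t) * (2 * cos t * (- sin t))) / ((1 + (cos t)\<^sup>2) * (1 + (cos t)\<^sup>2))) (at t)"
        using pos by (auto intro!: derivative_eq_intros)
      moreover have "(cos t * cos t + (- sin t) * sin t) * (1 + (cos t)\<^sup>2)
              - (cos t * sin t) * (2 * cos t * (- sin t)) = 3 * c - 1"
      proof -
        have "(cos t * sin t) * (2 * cos t * (- sin t)) = - 2 * (cos t * cos t) * (sin t * sin t)" by simp
        then have a: "(cos t * sin t) * (2 * cos t * (- sin t)) = - 2 * c * (1 - c)" unfolding s cc .
        have b: "cos t * cos t + (- sin t) * sin t = c - (1 - c)" using s cc by simp
        show ?thesis unfolding a b c_def[symmetric] by (simp add: algebra_simps)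
      qed
      ultimately show ?thesis by (simp add: power2_eq_square c_def)
    qed
    have u2: "1 + (?u t)\<^sup>2 = (1 + 3 * c) / (1 + c)\<^sup>2"
    proof -
      have "(?u t)\<^sup>2 = c * (1 - c) / (1 + c)\<^sup>2"
        using s by (simp add: power_divide power_mult_distrib c_def)
      moreover have "1 = (1 + c)\<^sup>2 / (1 + c)\<^sup>2" using c0 by simp
      ultimately have "1 + (?u t)\<^sup>2 = ((1 + c)\<^sup>2 + c * (1 - c)) / (1 + c)\<^sup>2"
        by (simp add: add_divide_distrib)
      then show ?thesis by (simp add: power2_eq_square algebra_simps)
    qed
    have "((\<lambda>t. arctan (?u t)) has_real_derivative inverse (1 + (?u t)\<^sup>2) * ((3 * c - 1) / (1 + c)\<^sup>2)) (at t)"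
      by (rule DERIV_chain2[OF DERIV_arctan du])
    moreover have "inverse (1 + (?u t)\<^sup>2) * ((3 * c - 1) / (1 + c)\<^sup>2) = (3 * c - 1) / (1 + 3 * c)"
      unfolding u2 using c0 by (simp add: divide_simps)
    ultimately have "(?g has_real_derivative (1 - (3 * c - 1) / (1 + 3 * c)) / 2) (at t)"
      by (intro DERIV_cdivide DERIV_diff DERIV_ident) simp
    moreover have "(1 - (3 * c - 1) / (1 + 3 * c)) / 2 = 1 / (1 + 3 * c)"
      using c0 by (simp add: divide_simps)
    ultimately show ?thesis unfolding c_def by metis
  qed
  then have "arcsine_mean (\<lambda>x. 1 / (1 + 3 * x)) = 2 / pi * (?g (pi/2) - ?g 0)"
    by (intro arcsine_mean_eqI)
  then show ?thesis by simp
qed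

text \<open>In \<open>bond_op_lift\<close>, the entry for the total together with that for age 0
  forces \<open>3 * (x * ker x) = 3/2 - ker x\<close>, and this is its solution.\<close>

definition ker :: "real \<Rightarrow> real" where "ker x = 3 / (2 * (1 + 3 * x))"

lemma cont_ker [continuous_intros]: "cont01 ker"
  unfolding ker_def by (intro continuous_intros) auto

lemma catalan_ker: "catalan_mean ker = 1"
proof -
  have "arcsine_mean (\<lambda>x. (1 - x) * ker x) = arcsine_mean (\<lambda>x. 2 * (1 / (1 + 3 * x)) + (- 1/2))"
    by (rule arcsine_mean_cong) (auto simp: ker_def divide_simps)
  also have "\<dots> = 1/2"
    by (subst arcsine_mean_add)
       (auto intro!: continuous_intros simp: arcsine_mean_cmult arcsine_mean_resolvent arcsine_mean_const simp del: times_divide_eq_right)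
  finally show ?thesis unfolding catalan_mean_def by simp
qed

lemma ker_mult: "x \<in> {0..1} \<Longrightarrow> 3 * (x * ker x) = 3/2 - ker x"
  by (auto simp: ker_def divide_simps)

lemma catalan_ker_mult:
  assumes "cont01 \<phi>"
  shows "catalan_mean (\<lambda>x. \<phi> x * (x * ker x)) = catalan_mean \<phi> / 2 - catalan_mean (\<lambda>x. \<phi> x * ker x) / 3"
proof -
  have "catalan_mean (\<lambda>x. \<phi> x * (x * ker x)) = catalan_mean (\<lambda>x. (1/2) * \<phi> x - (1/3) * (\<phi> x * ker x))"
  proof (rule catalan_mean_cong)
    fix x :: real assume "x \<in> {0..1}"
    then have "x * ker x = 1/2 - ker x / 3" using ker_mult by fastforce
    then show "\<phi> x * (x * ker x) = (1/2) * \<phi> x - (1/3) * (\<phi> x * ker x)"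
      by (simp only:) (simp add: algebra_simps)
  qed
  also have "\<dots> = catalan_mean \<phi> / 2 - catalan_mean (\<lambda>x. \<phi> x * ker x) / 3"
    using catalan_mean_cmult[of "1/2" \<phi>] catalan_mean_cmult[of "1/3" "\<lambda>x. \<phi> x * ker x"] assms
    by (subst catalan_mean_diff) (auto intro!: continuous_intros)
  finally show ?thesis .
qed

definition theta :: "nat \<Rightarrow> real" where "theta n = catalan_mean (\<lambda>x. x ^ n * ker x)"

lemma theta_0: "theta 0 = 1"
  by (simp add: theta_def catalan_ker)

lemma theta_Suc: "theta (Suc n) = cat n / 2 - theta n / 3"
proof -
  have "cont01 (\<lambda>x. x ^ n)" by (intro continuous_intros)
  from catalan_ker_mult[OF this] show ?thesis
    unfolding theta_def catalan_moment by (simp add: mult_ac)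
qed

section \<open>Generating function of the Catalan weights\<close>

lemma gbinomial_half_cat: "(-1) ^ Suc n * ((1/2::real) gchoose Suc n) = - cat n / 2"
proof (induction n)
  case 0 then show ?case by simp
next
  case (Suc n)
  have "((1/2::real) gchoose Suc (Suc n)) * (n + 2) = ((1/2) gchoose Suc n) * (1/2 - (n + 1))"
    using gbinomial_mult_1[of "1/2::real" "Suc n"] by (simp add: algebra_simps)
  then have e: "(1/2::real) gchoose Suc (Suc n) = ((1/2) gchoose Suc n) * (1/2 - (n + 1)) / (n + 2)"
    by (simp add: field_simps)
  have "(-1) ^ Suc (Suc n) * ((1/2::real) gchoose Suc (Suc n))
     = ((-1) ^ Suc n * ((1/2) gchoose Suc n)) * (n + 1/2) / (n + 2)"
    unfolding e by (simp add: divide_simps) (simp add: algebra_simps)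
  also have "\<dots> = - cat (Suc n) / 2" unfolding Suc by (simp add: divide_simps) (simp add: algebra_simps)
  finally show ?case .
qed

definition cat_fps :: "real fps" where "cat_fps = Abs_fps cat"

text \<open>The bracket is \<open>sqrt (1 - X)\<close>, written as the binomial series with exponent
  1/2; Vandermonde's identity squares it.\<close>

lemma cat_fps_quadratic: "(1 - fps_const (1/2) * fps_X * cat_fps)\<^sup>2 = 1 - fps_X"
proof -
  define Y where "Y = Abs_fps (\<lambda>n. (-1) ^ n * ((1/2::real) gchoose n))"
  have "Y = 1 - fps_const (1/2) * fps_X * cat_fps"
  proof (rule fps_ext)
    fix n
    show "fps_nth Y n = fps_nth (1 - fps_const (1/2) * fps_X * cat_fps) n"
    proof (cases n)
      case (Suc m)
      then show ?thesis using gbinomial_half_cat[of m]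
        by (simp add: Y_def cat_fps_def mult.assoc)
    qed (simp add: Y_def)
  qed
  moreover have "Y * Y = 1 - fps_X"
  proof (rule fps_ext)
    fix n
    have "fps_nth (Y * Y) n = (\<Sum>i=0..n. (-1) ^ n * (((1/2::real) gchoose i) * ((1/2) gchoose (n - i))))"
      unfolding fps_mult_nth Y_def
      by (rule sum.cong) (auto simp: power_add[symmetric] mult_ac)
    also have "\<dots> = (-1) ^ n * ((1::real) gchoose n)"
      using gbinomial_Vandermonde[of "1/2::real" "1/2" n]
      by (simp add: sum_distrib_left[symmetric] atMost_atLeast0)
    also have "\<dots> = fps_nth (1 - fps_X) n"
    proof (cases "n \<le> 1")
      case True then have "n = 0 \<or> n = 1" by auto
      then show ?thesis by auto
    next
      case False
      then have "1 choose n = 0" by (intro binomial_eq_0) simp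
      then have "(1::real) gchoose n = 0" using binomial_gbinomial[of 1 n, where ?'a=real] by (metis of_nat_0 of_nat_1)
      then show ?thesis using False by (simp add: fps_X_def)
    qed
    finally show "fps_nth (Y * Y) n = fps_nth (1 - fps_X) n" .
  qed
  ultimately show ?thesis by (simp add: power2_eq_square)
qed

section \<open>Liggett's inequality for the renewal measure\<close>

text \<open>A vector \<open>v\<close> is a weighting of the age of the renewal process, multiplied by the probabilities \<open>cat k\<close>
  of these ages: \<open>v (Suc k)\<close> belongs to age \<open>k\<close>, and \<open>v 0\<close> is the sum of all entries, carried
  along formally to avoid infinite series. \<open>shift_op\<close> passes one site, and \<open>thin_op c\<close> weights a point
  at the current site by \<open>c\<close>.\<close>

fun renewal :: "nat \<Rightarrow> real" where
  "renewal 0 = 2"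
| "renewal (Suc k) = cat k"

fun shift_op :: "(nat \<Rightarrow> real) \<Rightarrow> nat \<Rightarrow> real" where
  "shift_op v 0 = v 0"
| "shift_op v (Suc k) = v (Suc (Suc k)) + v 1 * gap k"

fun thin_op :: "real \<Rightarrow> (nat \<Rightarrow> real) \<Rightarrow> nat \<Rightarrow> real" where
  "thin_op c v 0 = v 0 - (1 - c) * v 1"
| "thin_op c v (Suc k) = (if k = 0 then c * v 1 else v (Suc k))"

text \<open>An occupied site sends one bond to each of two neighbouring sites of the next level, and each
  bond is closed with probability \<open>1/3\<close>.\<close>

definition bond_op :: "(nat \<Rightarrow> real) \<Rightarrow> nat \<Rightarrow> real" where
  "bond_op v = thin_op (1/3) (shift_op (thin_op (1/3) v))"

text \<open>The initial value 3 undoes the thinning by 1/3 that \<open>bond_op\<close> applies at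
  age 0 after the shift. Hence \<open>kap 0\<close> is a third of
  \<open>ker x * poly_ker 0 x\<close> and is treated separately.\<close>

fun poly_ker :: "nat \<Rightarrow> real \<Rightarrow> real" where
  "poly_ker 0 x = 3"
| "poly_ker (Suc k) x = x * poly_ker k x - gap k / 3"

definition kap :: "nat \<Rightarrow> real \<Rightarrow> real" where
  "kap k x = (if k = 0 then ker x else ker x * poly_ker k x)"

lemma cont_poly_ker [continuous_intros]: "cont01 (poly_ker k)"
proof (induction k)
  case (Suc k)
  then show ?case by (auto intro!: continuous_intros)
qed (auto intro!: continuous_intros)

lemma cont_kap [continuous_intros]: "cont01 (kap k)"
  unfolding kap_def by (cases "k = 0") (auto intro!: continuous_intros)

text \<open>The operator \<open>Q\<close>. Its kernel is the solution of the recursion that \<open>bond_op_lift\<close> forces, and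
  \<open>catalan_ker\<close> is exactly what makes \<open>lift_one\<close> hold.\<close>

fun lift :: "(real \<Rightarrow> real) \<Rightarrow> nat \<Rightarrow> real" where
  "lift \<phi> 0 = 2 * arcsine_mean \<phi>"
| "lift \<phi> (Suc k) = catalan_mean (\<lambda>x. \<phi> x * kap k x)"

lemma gap_0: "gap 0 = 3/4" by (simp add: gap_def)

lemma arcsine_mean_mult_x:
  assumes "cont01 \<phi>"
  shows "2 * arcsine_mean (\<lambda>x. x * \<phi> x) = 2 * arcsine_mean \<phi> - catalan_mean \<phi>"
proof -
  have "arcsine_mean \<phi> = arcsine_mean (\<lambda>x. x * \<phi> x + (1 - x) * \<phi> x)"
    by (rule arcsine_mean_cong) (simp add: algebra_simps)
  also have "\<dots> = arcsine_mean (\<lambda>x. x * \<phi> x) + arcsine_mean (\<lambda>x. (1 - x) * \<phi> x)"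
    by (rule arcsine_mean_add) (auto intro!: continuous_intros assms)
  finally show ?thesis unfolding catalan_mean_def by simp
qed

lemma lift_2:
  assumes "cont01 \<phi>"
  shows "lift \<phi> 2 = 3/2 * catalan_mean \<phi> - 5/4 * lift \<phi> 1"
proof -
  have "lift \<phi> 2 = catalan_mean (\<lambda>x. 3 * (\<phi> x * (x * ker x)) - 1/4 * (\<phi> x * ker x))"
    by (simp add: numeral_2_eq_2 kap_def gap_0) (simp add: algebra_simps)
  also have "\<dots> = 3 * catalan_mean (\<lambda>x. \<phi> x * (x * ker x)) - 1/4 * catalan_mean (\<lambda>x. \<phi> x * ker x)"
    using catalan_mean_cmult[of 3 "\<lambda>x. \<phi> x * (x * ker x)"] catalan_mean_cmult[of "1/4" "\<lambda>x. \<phi> x * ker x"] assms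
    by (subst catalan_mean_diff) (auto intro!: continuous_intros)
  also have "\<dots> = 3/2 * catalan_mean \<phi> - 5/4 * lift \<phi> 1"
    unfolding catalan_ker_mult[OF assms] by (simp add: kap_def)
  finally show ?thesis .
qed

lemma lift_Suc:
  assumes "cont01 \<phi>"
  shows "lift (\<lambda>x. x * \<phi> x) (Suc (Suc k)) = lift \<phi> (Suc (Suc (Suc k))) + gap (Suc k) / 3 * lift \<phi> 1"
proof -
  have "lift (\<lambda>x. x * \<phi> x) (Suc (Suc k))
      = catalan_mean (\<lambda>x. \<phi> x * kap (Suc (Suc k)) x + gap (Suc k) / 3 * (\<phi> x * ker x))"
    by (simp add: kap_def algebra_simps)
  also have "\<dots> = lift \<phi> (Suc (Suc (Suc k))) + gap (Suc k) / 3 * lift \<phi> 1"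
    using catalan_mean_cmult[of "gap (Suc k) / 3" "\<lambda>x. \<phi> x * ker x"] assms
    by (subst catalan_mean_add) (auto intro!: continuous_intros simp: kap_def)
  finally show ?thesis .
qed

lemma lift_mult_x_1:
  assumes "cont01 \<phi>"
  shows "lift (\<lambda>x. x * \<phi> x) 1 = catalan_mean \<phi> / 2 - lift \<phi> 1 / 3"
  using catalan_ker_mult[OF assms] by (simp add: kap_def mult_ac)

lemma bond_op_lift:
  assumes "cont01 \<phi>"
  shows "bond_op (lift \<phi>) = lift (\<lambda>x. x * \<phi> x)"
proof
  fix n
  define G where "G = lift \<phi>"
  have G2: "G 2 = 3/2 * catalan_mean \<phi> - 5/4 * G 1" using lift_2[OF assms] by (simp add: G_def)
  have t: "shift_op (thin_op (1/3) G) 1 = G 2 + G 1 / 4" by (simp add: gap_0 numeral_2_eq_2)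
  consider "n = 0" | "n = 1" | k where "n = Suc (Suc k)"
    by (metis One_nat_def nat.exhaust)
  then have "bond_op G n = lift (\<lambda>x. x * \<phi> x) n"
  proof cases
    case 1
    have "bond_op G 0 = G 0 - 2/3 * G 1 - 2/3 * (G 2 + G 1 / 4)"
      unfolding bond_op_def thin_op.simps(1) t by simp
    also have "\<dots> = G 0 - catalan_mean \<phi>" unfolding G2 by (simp add: field_simps)
    finally show ?thesis using arcsine_mean_mult_x[OF assms] 1 by (simp add: G_def)
  next
    case 2
    have "bond_op G 1 = (G 2 + G 1 / 4) / 3"
      unfolding bond_op_def using t by simp
    then show ?thesis using 2 G2 lift_mult_x_1[OF assms] by (simp add: G_def)
  next
    case 3
    then show ?thesis using lift_Suc[OF assms, of k] by (simp add: G_def bond_op_def)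
  qed
  then show "bond_op (lift \<phi>) n = lift (\<lambda>x. x * \<phi> x) n" by (simp add: G_def)
qed

text \<open>Unrolls the recursion of \<open>poly_ker\<close>; each round multiplies by
  \<open>x\<close>, which the exponent \<open>j\<close> absorbs. For \<open>j = 0\<close> the
  right-hand side is the convolution evaluated next.\<close>

lemma catalan_ker_poly_ker:
  "catalan_mean (\<lambda>x. x ^ j * (ker x * poly_ker k x))
     = 3 * theta (j + k) - (\<Sum>i<k. gap i * theta (j + (k - Suc i))) / 3"
proof (induction k arbitrary: j)
  case 0
  then show ?case using catalan_mean_cmult[of 3 "\<lambda>x. x ^ j * ker x"] by (simp add: theta_def mult_ac)
next
  case (Suc k)
  have "catalan_mean (\<lambda>x. x ^ j * (ker x * poly_ker (Suc k) x))
      = catalan_mean (\<lambda>x. x ^ Suc j * (ker x * poly_ker k x) - gap k / 3 * (x ^ j * ker x))"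
    by (rule catalan_mean_cong) (simp add: algebra_simps)
  also have "\<dots> = catalan_mean (\<lambda>x. x ^ Suc j * (ker x * poly_ker k x)) - gap k / 3 * theta j"
    using catalan_mean_cmult[of "gap k / 3" "\<lambda>x. x ^ j * ker x"]
    by (subst catalan_mean_diff) (auto intro!: continuous_intros simp: theta_def simp del: power_Suc)
  also have "\<dots> = 3 * theta (Suc j + k) - (\<Sum>i<k. gap i * theta (Suc j + (k - Suc i))) / 3 - gap k / 3 * theta j"
    unfolding Suc ..
  also have "(\<Sum>i<k. gap i * theta (Suc j + (k - Suc i))) = (\<Sum>i<k. gap i * theta (j + (Suc k - Suc i)))"
    by (rule sum.cong) (auto simp: Suc_diff_Suc)
  finally show ?case by (simp add: field_simps)
qed

text \<open>In generating functions the claim is \<open>(3 - X * g / 3) * \<Theta> = P + 2\<close>;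
  the 2 only adjusts the constant coefficient.\<close>

lemma theta_convolution:
  "3 * theta (Suc k) - (\<Sum>i<Suc k. gap i * theta (k - i)) / 3 = cat (Suc k)"
proof -
  define \<Theta> where "\<Theta> = Abs_fps theta"
  define g where "g = Abs_fps gap"
  let ?c = "fps_const :: real \<Rightarrow> real fps"
  let ?X = "fps_X :: real fps"
  let ?P = "cat_fps"
  have th: "\<Theta> * (1 + ?c (1/3) * ?X) = 1 + ?c (1/2) * ?X * ?P"
  proof (rule fps_ext)
    fix n
    have "\<Theta> * (1 + ?c (1/3) * ?X) = \<Theta> + ?c (1/3) * (?X * \<Theta>)" by (simp add: algebra_simps)
    then show "fps_nth (\<Theta> * (1 + ?c (1/3) * ?X)) n = fps_nth (1 + ?c (1/2) * ?X * ?P) n"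
      by (cases n) (simp_all add: mult.assoc \<Theta>_def cat_fps_def theta_0 theta_Suc)
  qed
  have gg: "?X * g = 1 - (1 - ?X) * ?P"
  proof (rule fps_ext)
    fix n
    have e: "1 - (1 - ?X) * ?P = 1 - ?P + ?X * ?P" by (simp add: algebra_simps)
    show "fps_nth (?X * g) n = fps_nth (1 - (1 - ?X) * ?P) n"
      unfolding e by (cases n) (simp_all add: g_def cat_fps_def gap_def)
  qed
  have q: "?c (1/4) * ?X * ?X * ?P * ?P = ?X * ?P - ?X"
  proof -
    have "?c (1/2) * ?c (1/2) = ?c (1/4)" "?c (1/2) + ?c (1/2) = 1"
      by (simp_all add: fps_const_mult fps_const_add)
    moreover have "q * X * X * P * P = X * P - X"
      if "h * h = q" "h + h = 1" "(1 - h * X * P) * (1 - h * X * P) = 1 - X" for h q X P :: "real fps"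
    proof -
      have "1 - X = 1 - (h + h) * (X * P) + (h * h) * X * X * P * P"
        unfolding that(3)[symmetric] by (simp add: algebra_simps)
      then show ?thesis unfolding that(1,2) by (simp add: algebra_simps)
    qed
    ultimately show ?thesis using cat_fps_quadratic unfolding power2_eq_square by blast
  qed
  have "(?c 3 - ?c (1/3) * (?X * g)) * \<Theta> = ?P + 2"
  proof -
    \<comment> \<open>Multiplication by \<open>1 + X/3\<close> eliminates \<open>\<Theta>\<close>
      through \<open>th\<close>, and the extra \<open>X\<close> creates the product
      \<open>X * X * P * P\<close> that \<open>q\<close> can reduce. What remains is polynomial
      algebra.\<close>
    have "?X * ((?c 3 - ?c (1/3) * (?X * g)) * (\<Theta> * (1 + ?c (1/3) * ?X)))
        = ?X * ((?P + 2) * (1 + ?c (1/3) * ?X))"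
    proof -
      have "?c (1/4) * 4 = 1" "?c (1/2) = 2 * ?c (1/4)" "?c (1/3) * 3 = 1" "?c 3 = 3"
        by (simp_all add: numeral_fps_const fps_const_mult)
      moreover have "X * ((t - a * (1 - (1 - X) * P)) * (1 + h * X * P)) = X * ((P + 2) * (1 + a * X))"
        if "q * 4 = 1" "h = 2 * q" "a * 3 = 1" "t = 3" "q * X * X * P * P = X * P - X"
        for h q a t X P :: "real fps"
        using that by algebra
      ultimately show ?thesis unfolding th gg using q by blast
    qed
    then have "((?c 3 - ?c (1/3) * (?X * g)) * \<Theta>) * (1 + ?c (1/3) * ?X)
        = (?P + 2) * (1 + ?c (1/3) * ?X)"
      by (simp add: mult.assoc)
    moreover have "fps_nth (1 + ?c (1/3) * ?X) 0 \<noteq> 0" by simp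
    then have "1 + ?c (1/3) * ?X \<noteq> 0" by force
    ultimately show ?thesis by simp
  qed
  then have "fps_nth (?c 3 * \<Theta> - ?c (1/3) * (?X * (g * \<Theta>))) (Suc k) = fps_nth (?P + 2) (Suc k)"
    by (simp add: algebra_simps)
  moreover have "(\<Sum>i=0..k. gap i * theta (k - i)) = (\<Sum>i<Suc k. gap i * theta (k - i))"
    by (simp add: lessThan_Suc_atMost atMost_atLeast0)
  moreover have "fps_nth (?c 3 * \<Theta> - ?c (1/3) * (?X * (g * \<Theta>))) (Suc k)
      = 3 * theta (Suc k) - fps_nth (g * \<Theta>) k / 3"
    by (simp add: \<Theta>_def)
  moreover have "fps_nth (g * \<Theta>) k = (\<Sum>i=0..k. gap i * theta (k - i))"
    by (simp add: fps_mult_nth g_def \<Theta>_def)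
  moreover have "fps_nth (?P + 2) (Suc k) = cat (Suc k)"
    by (simp add: cat_fps_def numeral_fps_const del: cat.simps)
  ultimately show ?thesis by linarith
qed

lemma lift_one: "lift (\<lambda>_. 1) = renewal"
proof
  fix n
  consider "n = 0" | "n = 1" | k where "n = Suc (Suc k)"
    by (metis One_nat_def nat.exhaust)
  then show "lift (\<lambda>_. 1) n = renewal n"
  proof cases
    case 3
    then show ?thesis using catalan_ker_poly_ker[of 0 "Suc k"] theta_convolution[of k]
      by (simp add: kap_def del: cat.simps poly_ker.simps sum.lessThan_Suc)
  qed (simp_all add: arcsine_mean_const kap_def catalan_ker)
qed

section \<open>The effect of an empty site\<close>

fun defect :: "nat \<Rightarrow> real" where
  "defect 0 = 0"
| "defect (Suc k) = gap k - (if k = 0 then 1 else 0)"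

lemma lift_add:
  "cont01 \<phi> \<Longrightarrow> cont01 \<psi> \<Longrightarrow> lift (\<lambda>x. \<phi> x + \<psi> x) n = lift \<phi> n + lift \<psi> n"
  by (cases n) (auto simp: arcsine_mean_add distrib_right catalan_mean_add intro!: catalan_mean_add continuous_intros)

lemma lift_cmult: "lift (\<lambda>x. c * \<phi> x) n = c * lift \<phi> n"
  by (cases n) (auto simp: arcsine_mean_cmult mult.assoc catalan_mean_cmult)

text \<open>As \<open>m * (1 - x)\<close> is \<open>m\<close> times \<open>1\<close> minus
  \<open>m\<close> times \<open>x * 1\<close>, \<open>bond_op_lift\<close> and
  \<open>lift_one\<close> apply to every term. The thinnings that distinguish \<open>bond_op\<close>
  from \<open>shift_op\<close> then combine into a multiple of one vector of total 0: a fresh gap in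
  place of a point.\<close>

lemma lift_shift:
  assumes "cont01 \<phi>"
  shows "lift (\<lambda>x. x * \<phi> x + catalan_mean \<phi> * (1 - x)) n
     = shift_op (lift \<phi>) n + 2/3 * (catalan_mean \<phi> - lift \<phi> 1) * defect n"
proof -
  define m where "m = catalan_mean \<phi>"
  have "lift (\<lambda>x. x * \<phi> x + m * (1 - x)) n = lift (\<lambda>x. x * \<phi> x) n + lift (\<lambda>x. m * 1 + (- m) * (x * 1)) n"
    using assms by (subst lift_add[symmetric]) (auto intro!: continuous_intros simp: algebra_simps)
  also have "lift (\<lambda>x. m * 1 + (- m) * (x * 1)) n = m * lift (\<lambda>_. 1) n + (- m) * lift (\<lambda>x. x * 1) n"
    by (subst lift_add) (auto intro!: continuous_intros simp only: lift_cmult)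
  also have "lift (\<lambda>x. x * 1) = bond_op (lift (\<lambda>_. 1))" using bond_op_lift[of "\<lambda>_. 1"] by simp
  also have "lift (\<lambda>x. x * \<phi> x) = bond_op (lift \<phi>)" using bond_op_lift[OF assms] by simp
  finally have e: "lift (\<lambda>x. x * \<phi> x + m * (1 - x)) n
      = bond_op (lift \<phi>) n + (m * renewal n - m * bond_op renewal n)"
    unfolding lift_one by simp
  define G where "G = lift \<phi>"
  have G2: "G 2 = 3/2 * m - 5/4 * G 1" using lift_2[OF assms] by (simp add: G_def m_def)
  have "bond_op G n + (m * renewal n - m * bond_op renewal n)
      = shift_op G n + 2/3 * (m - G 1) * defect n"
  proof -
    consider "n = 0" | "n = 1" | k where "n = Suc (Suc k)"
      by (metis One_nat_def nat.exhaust)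
    then show ?thesis
    proof cases
      case 1
      then show ?thesis using G2
        by (simp add: bond_op_def gap_0 numeral_2_eq_2 field_simps)
    next
      case 2
      then show ?thesis using G2
        by (simp add: bond_op_def gap_0 numeral_2_eq_2 field_simps)
    next
      case 3
      then show ?thesis
        by (simp add: bond_op_def gap_def field_simps del: cat.simps(2))
    qed
  qed
  with e show ?thesis by (simp add: G_def m_def)
qed

section \<open>A cone of functions with nonnegative mean\<close>

definition rises :: "(real \<Rightarrow> real) \<Rightarrow> bool" where
  "rises \<psi> \<longleftrightarrow> (\<forall>x\<in>{0..1}. \<forall>y\<in>{0..1}. x \<le> y \<longrightarrow> \<psi> x > 0 \<longrightarrow> \<psi> x \<le> \<psi> y)"

definition catalan_slope :: "(real \<Rightarrow> real) \<Rightarrow> real" where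
  "catalan_slope \<psi> = catalan_mean (\<lambda>x. (1 - x) * \<psi> x)"

text \<open>Both signs needed below reduce to one fact: \<open>catalan_mean\<close> is nonnegative on this cone, which is
  stable under the maps of \<open>good_cone_step\<close>.\<close>

definition good_cone :: "(real \<Rightarrow> real) set" where
  "good_cone = {\<psi>. \<exists>\<psi>1 \<psi>2. \<psi> = (\<lambda>x. \<psi>1 x + \<psi>2 x) \<and> cont01 \<psi>1 \<and> cont01 \<psi>2 \<and> rises \<psi>1 \<and> rises \<psi>2 \<and>
      (\<forall>x\<in>{0..1}. 0 \<le> \<psi>1 x) \<and> catalan_slope \<psi>2 \<le> 0 \<and> 0 \<le> catalan_mean \<psi>2}"

lemma good_coneI:
  "\<lbrakk>cont01 \<psi>1; cont01 \<psi>2; rises \<psi>1; rises \<psi>2; \<And>x. x \<in> {0..1} \<Longrightarrow> 0 \<le> \<psi>1 x;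
    catalan_slope \<psi>2 \<le> 0; 0 \<le> catalan_mean \<psi>2\<rbrakk> \<Longrightarrow> (\<lambda>x. \<psi>1 x + \<psi>2 x) \<in> good_cone"
  unfolding good_cone_def by blast

lemma good_coneE:
  assumes "\<psi> \<in> good_cone"
  obtains \<psi>1 \<psi>2 where "\<psi> = (\<lambda>x. \<psi>1 x + \<psi>2 x)" "cont01 \<psi>1" "cont01 \<psi>2" "rises \<psi>1" "rises \<psi>2"
    "\<And>x. x \<in> {0..1} \<Longrightarrow> 0 \<le> \<psi>1 x" "catalan_slope \<psi>2 \<le> 0" "0 \<le> catalan_mean \<psi>2"
  using assms unfolding good_cone_def by blast

lemma good_cone_cont: "\<psi> \<in> good_cone \<Longrightarrow> cont01 \<psi>"
  by (erule good_coneE) (auto intro!: continuous_intros)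

lemma good_cone_mean_nonneg: "\<psi> \<in> good_cone \<Longrightarrow> 0 \<le> catalan_mean \<psi>"
  by (erule good_coneE) (auto simp: catalan_mean_add intro!: add_nonneg_nonneg catalan_mean_nonneg)

lemma catalan_slope_add:
  "cont01 \<phi> \<Longrightarrow> cont01 \<psi> \<Longrightarrow> catalan_slope (\<lambda>x. \<phi> x + \<psi> x) = catalan_slope \<phi> + catalan_slope \<psi>"
  unfolding catalan_slope_def distrib_left by (subst catalan_mean_add) (auto intro!: continuous_intros)

lemma catalan_slope_cmult: "catalan_slope (\<lambda>x. c * \<phi> x) = c * catalan_slope \<phi>"
  unfolding catalan_slope_def using catalan_mean_cmult[of c "\<lambda>x. (1 - x) * \<phi> x"] by (simp add: mult_ac)

lemma catalan_slope_nonneg: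
  "cont01 \<phi> \<Longrightarrow> (\<And>x. x \<in> {0..1} \<Longrightarrow> 0 \<le> \<phi> x) \<Longrightarrow> 0 \<le> catalan_slope \<phi>"
  unfolding catalan_slope_def by (rule catalan_mean_nonneg) (auto intro!: continuous_intros)

lemma catalan_mean_mult_x:
  "cont01 \<phi> \<Longrightarrow> catalan_mean (\<lambda>x. x * \<phi> x) = catalan_mean \<phi> - catalan_slope \<phi>"
proof -
  assume c: "cont01 \<phi>"
  have "catalan_mean (\<lambda>x. x * \<phi> x) = catalan_mean (\<lambda>x. \<phi> x - (1 - x) * \<phi> x)"
    by (rule catalan_mean_cong) (simp add: algebra_simps)
  then show ?thesis using c unfolding catalan_slope_def
    by (subst (asm) catalan_mean_diff) (auto intro!: continuous_intros)
qed

text \<open>The difficulty is the mean of the remainder. Its slope is 0, so its means against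
  \<open>1\<close> and against \<open>x\<close> agree; and it changes sign at most once, at
  \<open>x0\<close>, so its mean against \<open>x - x0\<close> is nonnegative. Together,
  \<open>1 - x0\<close> times the mean is nonnegative.\<close>

lemma good_cone_rises:
  assumes c: "cont01 \<eta>" and r: "rises \<eta>" and N: "0 \<le> catalan_mean \<eta>"
  shows "\<eta> \<in> good_cone"
proof (cases "catalan_slope \<eta> \<le> 0")
  case True
  have "(\<lambda>x. 0 + \<eta> x) \<in> good_cone"
    by (rule good_coneI) (use assms True in \<open>auto simp: rises_def\<close>)
  then show ?thesis by simp
next
  case False
  text \<open>Remove the multiple of the positive part that makes the slope of the remainder vanish.\<close>
  define P where "P x = max (\<eta> x) 0" for x
  define R where "R x = \<eta> x - P x" for x
  have cP: "cont01 P" unfolding P_def by (intro continuous_intros c)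
  have cR: "cont01 R" unfolding R_def by (intro continuous_intros c cP)
  have chi: "\<eta> = (\<lambda>x. P x + R x)" by (auto simp: R_def)
  have R0: "R x \<le> 0" and P0: "P x \<ge> 0" for x by (auto simp: R_def P_def)
  have sR: "catalan_slope R \<le> 0"
  proof -
    have "0 \<le> catalan_slope (\<lambda>x. (-1) * R x)"
      by (rule catalan_slope_nonneg) (use R0 cR in \<open>auto intro!: continuous_intros\<close>)
    then show ?thesis unfolding catalan_slope_cmult by simp
  qed
  have sum: "catalan_slope \<eta> = catalan_slope P + catalan_slope R"
    by (subst chi) (rule catalan_slope_add[OF cP cR])
  have sP: "catalan_slope P > 0" using sum False sR by linarith
  define l where "l = - catalan_slope R / catalan_slope P"
  have l: "0 \<le> l" "l \<le> 1" using sR sP sum False by (auto simp: l_def divide_simps)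
  define \<eta>0 where "\<eta>0 x = l * P x + R x" for x
  have c0: "cont01 \<eta>0" unfolding \<eta>0_def by (intro continuous_intros cP cR)
  have s0: "catalan_slope \<eta>0 = 0"
  proof -
    have "catalan_slope \<eta>0 = l * catalan_slope P + catalan_slope R"
      unfolding \<eta>0_def using cP cR
      by (subst catalan_slope_add) (auto intro!: continuous_intros simp: catalan_slope_cmult)
    then show ?thesis using sP by (simp add: l_def)
  qed
  have v: "\<eta>0 x = (if \<eta> x > 0 then l * \<eta> x else \<eta> x)" for x
    by (auto simp: \<eta>0_def P_def R_def)
  have r0: "rises \<eta>0"
    unfolding rises_def
  proof (intro ballI impI)
    fix x y :: real assume a: "x \<in> {0..1}" "y \<in> {0..1}" "x \<le> y" "\<eta>0 x > 0"
    have p: "\<eta> x > 0" using a(4) by (auto simp: v split: if_splits)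
    with r a have "\<eta> x \<le> \<eta> y" by (auto simp: rises_def)
    with p show "\<eta>0 x \<le> \<eta>0 y" using l by (auto simp: v intro!: mult_left_mono)
  qed
  \<comment> \<open>A positive value at 1 alone would not count, as \<open>1 - x\<close> vanishes
    there. This yields \<open>x0 < 1\<close>, by which the last inequality is divided.\<close>
  have "\<exists>z\<in>{0..<1}. \<eta> z > 0"
  proof (rule ccontr)
    assume neg: "\<not> ?thesis"
    have "0 \<le> catalan_slope (\<lambda>x. (-1) * \<eta> x)"
      unfolding catalan_slope_def
    proof (rule catalan_mean_nonneg)
      fix x :: real assume "x \<in> {0..1}"
      then show "0 \<le> (1 - x) * (- 1 * \<eta> x)" using neg by (cases "x = 1") (auto simp: not_less intro!: mult_nonneg_nonpos)
    qed (intro continuous_intros c)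
    then show False using False unfolding catalan_slope_cmult by simp
  qed
  then obtain z where z: "z \<in> {0..<1}" "\<eta> z > 0" by blast
  define Z where "Z = {x\<in>{0..1}. \<eta> x > 0}"
  define x0 where "x0 = Inf Z"
  have zZ: "z \<in> Z" using z by (auto simp: Z_def)
  have bdd: "bdd_below Z" by (auto simp: Z_def intro: bdd_belowI[of _ 0])
  have x01: "x0 < 1" using cInf_lower[OF zZ bdd] z by (auto simp: x0_def)
  have sgn: "x0 * \<eta>0 x \<le> x * \<eta>0 x" if x: "x \<in> {0..1}" for x
  proof (cases "\<eta> x > 0")
    case True
    then have "x0 \<le> x" using cInf_lower[OF _ bdd, of x] x by (auto simp: Z_def x0_def)
    then show ?thesis using True l by (intro mult_right_mono) (auto simp: v)
  next
    case False
    have "x \<le> x0" unfolding x0_def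
    proof (rule cInf_greatest)
      fix y assume y: "y \<in> Z"
      show "x \<le> y"
      proof (rule ccontr)
        assume "\<not> x \<le> y"
        then have "\<eta> y \<le> \<eta> x" using r y x by (auto simp: rises_def Z_def)
        then show False using y False by (auto simp: Z_def)
      qed
    qed (use zZ in auto)
    then show ?thesis using False by (intro mult_right_mono_neg) (auto simp: v)
  qed
  have "x0 * catalan_mean \<eta>0 \<le> catalan_mean (\<lambda>x. x * \<eta>0 x)"
    unfolding catalan_mean_cmult[symmetric]
    by (rule catalan_mean_mono) (use sgn in \<open>auto intro!: continuous_intros c0\<close>)
  then have "0 \<le> (1 - x0) * catalan_mean \<eta>0"
    unfolding catalan_mean_mult_x[OF c0] s0 by (simp add: algebra_simps)
  then have N0: "0 \<le> catalan_mean \<eta>0" using x01 by (simp add: zero_le_mult_iff)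
  have "(\<lambda>x. (1 - l) * P x + \<eta>0 x) \<in> good_cone"
  proof (rule good_coneI)
    show "rises (\<lambda>x. (1 - l) * P x)"
      using r l by (auto simp: rises_def P_def max_def intro!: mult_left_mono split: if_splits) force+
  qed (use c0 r0 N0 s0 l P0 cP in \<open>auto intro!: continuous_intros\<close>)
  moreover have "(\<lambda>x. (1 - l) * P x + \<eta>0 x) = \<eta>"
    by (auto simp: \<eta>0_def R_def algebra_simps)
  ultimately show ?thesis by simp
qed

lemma good_cone_add_nonneg:
  assumes "\<eta> \<in> good_cone" "cont01 \<phi>" "\<And>x. x \<in> {0..1} \<Longrightarrow> 0 \<le> \<phi> x"
    "\<And>x y. 0 \<le> x \<Longrightarrow> x \<le> y \<Longrightarrow> y \<le> 1 \<Longrightarrow> \<phi> x \<le> \<phi> y"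
  shows "(\<lambda>x. \<phi> x + \<eta> x) \<in> good_cone"
  using assms(1)
proof (rule good_coneE)
  fix \<psi>1 \<psi>2 assume *: "\<eta> = (\<lambda>x. \<psi>1 x + \<psi>2 x)" "cont01 \<psi>1" "cont01 \<psi>2" "rises \<psi>1" "rises \<psi>2"
    "\<And>x. x \<in> {0..1} \<Longrightarrow> 0 \<le> \<psi>1 x" "catalan_slope \<psi>2 \<le> 0" "0 \<le> catalan_mean \<psi>2"
  have "(\<lambda>x. (\<phi> x + \<psi>1 x) + \<psi>2 x) \<in> good_cone"
  proof (rule good_coneI)
    show "rises (\<lambda>x. \<phi> x + \<psi>1 x)"
      unfolding rises_def
    proof (intro ballI impI)
      fix x y :: real assume a: "x \<in> {0..1}" "y \<in> {0..1}" "x \<le> y"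
      have "\<psi>1 x \<le> \<psi>1 y" using *(4) *(6)[of x] *(6)[of y] a unfolding rises_def by force
      then show "\<phi> x + \<psi>1 x \<le> \<phi> y + \<psi>1 y" using assms(4)[of x y] a by auto
    qed
  qed (use * assms in \<open>auto intro!: continuous_intros add_nonneg_nonneg\<close>)
  then show ?thesis by (simp add: * add.assoc)
qed

text \<open>The nonnegative part stays nonnegative and monotone. For the other part the added
  constant is at most 0, so the function still rises, and its mean grows by
  \<open>(1 - c) * (- m2)\<close>; its slope may become positive, and \<open>good_cone_rises\<close>
  then splits it anew. Monotonicity is required only where the function is positive, since
  multiplication by \<open>x\<close> would destroy it elsewhere.\<close>

lemma good_cone_step:
  assumes "\<psi> \<in> good_cone" "0 \<le> c" "c \<le> 1"
  shows "(\<lambda>x. x * \<psi> x + c * catalan_slope \<psi>) \<in> good_cone"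
  using assms(1)
proof (rule good_coneE)
  fix \<psi>1 \<psi>2 assume *: "\<psi> = (\<lambda>x. \<psi>1 x + \<psi>2 x)" "cont01 \<psi>1" "cont01 \<psi>2" "rises \<psi>1" "rises \<psi>2"
    "\<And>x. x \<in> {0..1} \<Longrightarrow> 0 \<le> \<psi>1 x" "catalan_slope \<psi>2 \<le> 0" "0 \<le> catalan_mean \<psi>2"
  define m1 m2 where "m1 = catalan_slope \<psi>1" and "m2 = catalan_slope \<psi>2"
  have m1: "m1 \<ge> 0" unfolding m1_def by (rule catalan_slope_nonneg) (use * in auto)
  have m2: "m2 \<le> 0" using * by (simp add: m2_def)
  have cm2: "c * m2 \<le> 0" using m2 assms by (simp add: mult_nonneg_nonpos)
  have "(\<lambda>x. x * \<psi>2 x + c * m2) \<in> good_cone"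
  proof (rule good_cone_rises)
    show "rises (\<lambda>x. x * \<psi>2 x + c * m2)"
      unfolding rises_def
    proof (intro ballI impI)
      fix x y :: real assume a: "x \<in> {0..1}" "y \<in> {0..1}" "x \<le> y" "0 < x * \<psi>2 x + c * m2"
      then have "x * \<psi>2 x > 0" using cm2 by linarith
      then have "\<psi>2 x > 0" using a by (auto simp: zero_less_mult_iff)
      moreover from this have "\<psi>2 x \<le> \<psi>2 y" using *(5) a by (auto simp: rises_def)
      ultimately have "x * \<psi>2 x \<le> y * \<psi>2 y" using a by (intro mult_mono) auto
      then show "x * \<psi>2 x + c * m2 \<le> y * \<psi>2 y + c * m2" by simp
    qed
    have "catalan_mean (\<lambda>x. x * \<psi>2 x + c * m2) = catalan_mean \<psi>2 - m2 + c * m2"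
      using *(3) by (subst catalan_mean_add) (auto intro!: continuous_intros simp: catalan_mean_mult_x catalan_mean_const m2_def)
    also have "\<dots> = catalan_mean \<psi>2 + (1 - c) * (- m2)" by (simp add: algebra_simps)
    also have "\<dots> \<ge> 0" using assms m2 * by (intro add_nonneg_nonneg mult_nonneg_nonneg) auto
    finally show "0 \<le> catalan_mean (\<lambda>x. x * \<psi>2 x + c * m2)" .
  qed (intro continuous_intros *)
  then have "(\<lambda>x. (x * \<psi>1 x + c * m1) + (x * \<psi>2 x + c * m2)) \<in> good_cone"
  proof (rule good_cone_add_nonneg)
    fix x y :: real assume a: "0 \<le> x" "x \<le> y" "y \<le> 1"
    then have "\<psi>1 x \<le> \<psi>1 y" using *(4) *(6)[of x] *(6)[of y] unfolding rises_def by force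
    then show "x * \<psi>1 x + c * m1 \<le> y * \<psi>1 y + c * m1"
      using a *(6)[of x] by (intro add_right_mono mult_mono) auto
  qed (use * m1 assms in \<open>auto intro!: continuous_intros add_nonneg_nonneg mult_nonneg_nonneg\<close>)
  moreover have "catalan_slope \<psi> = m1 + m2" unfolding *(1) m1_def m2_def by (rule catalan_slope_add) fact+
  ultimately show ?thesis by (simp add: *(1) algebra_simps)
qed

lemma good_cone_mult_x: "\<psi> \<in> good_cone \<Longrightarrow> (\<lambda>x. x * \<psi> x) \<in> good_cone"
  using good_cone_step[of \<psi> 0] by simp

text \<open>\<open>arcsine_mean (avoid (map site_factor bs))\<close> is the probability that the stationary renewal process
  has no point at the sites marked in \<open>bs\<close>; general factors \<open>c\<close> average over random marks.\<close>

fun avoid :: "real list \<Rightarrow> real \<Rightarrow> real" where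
  "avoid [] x = 1"
| "avoid (c # cs) x = x * avoid cs x + c * catalan_mean (avoid cs) * (1 - x)"

lemma cont_avoid [continuous_intros]: "cont01 (avoid cs)"
proof (induction cs)
  case Nil
  then show ?case by (auto intro!: continuous_intros)
next
  case (Cons c cs)
  have "avoid (c # cs) = (\<lambda>x. x * avoid cs x + c * catalan_mean (avoid cs) * (1 - x))" by auto
  then show ?case using Cons by (auto intro!: continuous_intros)
qed

lemma avoid_nonneg:
  assumes "\<forall>c\<in>set cs. 0 \<le> c" "x \<in> {0..1}"
  shows "0 \<le> avoid cs x"
  using assms
proof (induction cs arbitrary: x)
  case (Cons c cs)
  then have "0 \<le> catalan_mean (avoid cs)" by (intro catalan_mean_nonneg) (auto intro!: continuous_intros)
  with Cons show ?case by auto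
qed auto

lemma avoid_mono:
  assumes "list_all2 (\<lambda>c d. 0 \<le> c \<and> c \<le> d) cs ds" "x \<in> {0..1}"
  shows "avoid cs x \<le> avoid ds x"
  using assms
proof (induction cs ds arbitrary: x rule: list_all2_induct)
  case (Cons c cs d ds)
  have nn: "\<forall>c\<in>set cs. 0 \<le> c" using Cons.hyps(2) by (auto simp: list_all2_conv_all_nth in_set_conv_nth)
  have "catalan_mean (avoid cs) \<le> catalan_mean (avoid ds)"
    by (rule catalan_mean_mono) (auto intro!: continuous_intros Cons.IH)
  moreover have "0 \<le> catalan_mean (avoid cs)"
    by (rule catalan_mean_nonneg) (auto intro!: continuous_intros avoid_nonneg[OF nn])
  ultimately have "c * catalan_mean (avoid cs) * (1 - x) \<le> d * catalan_mean (avoid ds) * (1 - x)"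
    using Cons.hyps(1) Cons.prems by (intro mult_right_mono mult_mono) auto
  then show ?case using Cons.IH[OF Cons.prems] Cons.prems by (auto intro!: add_mono mult_left_mono)
qed auto

abbreviation site_factor :: "bool \<Rightarrow> real" where
  "site_factor b \<equiv> (if b then 0 else 1)"

text \<open>Each site is moved from \<open>avoid\<close> to \<open>\<psi>\<close> by taking
  adjoints: a marked site multiplies \<open>\<psi>\<close> by \<open>x\<close>, an unmarked one also
  adds the constant \<open>catalan_slope \<psi>\<close>. These are the maps of
  \<open>good_cone_step\<close> for \<open>c = 0\<close> and \<open>c = 1\<close>.\<close>

lemma good_cone_avoid:
  "\<psi> \<in> good_cone \<Longrightarrow> 0 \<le> catalan_mean (\<lambda>x. avoid (map site_factor bs) x * \<psi> x)"
proof (induction bs arbitrary: \<psi>)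
  case Nil
  then show ?case by (simp add: good_cone_mean_nonneg)
next
  case (Cons b bs)
  define \<phi> where "\<phi> = avoid (map site_factor bs)"
  have c: "cont01 \<phi>" "cont01 \<psi>" using Cons.prems by (auto simp: \<phi>_def good_cone_cont intro!: continuous_intros)
  show ?case
  proof (cases b)
    case True
    then show ?thesis using Cons.IH[OF good_cone_mult_x[OF Cons.prems]] by (simp add: mult_ac)
  next
    case False
    have "catalan_mean (\<lambda>x. avoid (map site_factor (b # bs)) x * \<psi> x)
        = catalan_mean (\<lambda>x. \<phi> x * (x * \<psi> x) + catalan_mean \<phi> * ((1 - x) * \<psi> x))"
      using False by (simp add: \<phi>_def algebra_simps)
    also have "\<dots> = catalan_mean (\<lambda>x. \<phi> x * (x * \<psi> x)) + catalan_mean \<phi> * catalan_slope \<psi>"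
      using c by (subst catalan_mean_add) (auto intro!: continuous_intros simp: catalan_mean_cmult catalan_slope_def)
    also have "\<dots> = catalan_mean (\<lambda>x. \<phi> x * (x * \<psi> x) + catalan_slope \<psi> * \<phi> x)"
      using c by (subst catalan_mean_add) (auto intro!: continuous_intros simp: catalan_mean_cmult)
    also have "\<dots> = catalan_mean (\<lambda>x. \<phi> x * (x * \<psi> x + 1 * catalan_slope \<psi>))"
      by (simp add: algebra_simps)
    also have "\<dots> \<ge> 0" unfolding \<phi>_def
      by (rule Cons.IH) (rule good_cone_step[OF Cons.prems], auto)
    finally show ?thesis .
  qed
qed

text \<open>The function \<open>1 - ker x\<close> is increasing with mean 0 by
  \<open>catalan_ker\<close>, hence in the cone. This is the sign of the coefficient of
  \<open>defect\<close> in \<open>lift_shift\<close>.\<close>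

lemma lift_avoid_le:
  "lift (avoid (map site_factor bs)) 1 \<le> catalan_mean (avoid (map site_factor bs))"
proof -
  define \<phi> where "\<phi> = avoid (map site_factor bs)"
  have c: "cont01 \<phi>" by (auto simp: \<phi>_def intro!: continuous_intros)
  have "(\<lambda>x. 1 - ker x) \<in> good_cone"
  proof (rule good_cone_rises)
    show "rises (\<lambda>x. 1 - ker x)"
      by (auto simp: rises_def ker_def divide_simps) (simp add: algebra_simps)
    show "0 \<le> catalan_mean (\<lambda>x. 1 - ker x)"
      by (subst catalan_mean_diff) (auto intro!: continuous_intros simp: catalan_ker catalan_mean_const)
  qed (intro continuous_intros)
  then have "0 \<le> catalan_mean (\<lambda>x. \<phi> x * (1 - ker x))" unfolding \<phi>_def by (rule good_cone_avoid)
  also have "\<dots> = catalan_mean (\<lambda>x. \<phi> x - \<phi> x * ker x)" by (simp add: algebra_simps)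
  also have "\<dots> = catalan_mean \<phi> - catalan_mean (\<lambda>x. \<phi> x * ker x)"
    using c by (subst catalan_mean_diff) (auto intro!: continuous_intros)
  finally show ?thesis by (simp add: \<phi>_def kap_def)
qed

section \<open>Words of occupied and empty sites\<close>

fun word_op :: "bool list \<Rightarrow> (nat \<Rightarrow> real) \<Rightarrow> nat \<Rightarrow> real" where
  "word_op [] v = v"
| "word_op (b # bs) v = (if b then bond_op (word_op bs v) else shift_op (word_op bs v))"

lemma word_op_append: "word_op (as @ bs) v = word_op as (word_op bs v)"
  by (induction as) auto

lemma shift_op_lin: "shift_op (\<lambda>n. u n + c * v n) = (\<lambda>n. shift_op u n + c * shift_op v n)"
proof
  fix n show "shift_op (\<lambda>n. u n + c * v n) n = shift_op u n + c * shift_op v n"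
    by (cases n) (auto simp: algebra_simps)
qed

lemma thin_op_lin: "thin_op a (\<lambda>n. u n + c * v n) = (\<lambda>n. thin_op a u n + c * thin_op a v n)"
proof
  fix n show "thin_op a (\<lambda>n. u n + c * v n) n = thin_op a u n + c * thin_op a v n"
    by (cases n) (auto simp: algebra_simps)
qed

lemma word_op_lin: "word_op bs (\<lambda>n. u n + c * v n) = (\<lambda>n. word_op bs u n + c * word_op bs v n)"
  by (induction bs) (auto simp: bond_op_def shift_op_lin thin_op_lin)

text \<open>Moments of the density \<open>(1 - x) * \<psi> x\<close>, minus an atom \<open>c\<close>
  at age 0. Formally the powers of \<open>x\<close> sum to \<open>1 / (1 - x)\<close>, which
  explains the entry for the total.\<close>

fun atom_vec :: "(real \<Rightarrow> real) \<Rightarrow> real \<Rightarrow> nat \<Rightarrow> real" where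
  "atom_vec \<psi> c 0 = catalan_mean \<psi> - c"
| "atom_vec \<psi> c (Suc k) = catalan_mean (\<lambda>x. (1 - x) * \<psi> x * x ^ k) - (if k = 0 then c else 0)"

lemma atom_vec_1: "atom_vec \<psi> c 1 = catalan_slope \<psi> - c"
  by (simp add: catalan_slope_def)

lemma shift_atom_vec:
  assumes "cont01 \<psi>"
  shows "shift_op (atom_vec \<psi> c) = atom_vec (\<lambda>x. x * \<psi> x + (catalan_slope \<psi> - c)) 0"
proof
  fix n
  define m where "m = catalan_slope \<psi> - c"
  show "shift_op (atom_vec \<psi> c) n = atom_vec (\<lambda>x. x * \<psi> x + (catalan_slope \<psi> - c)) 0 n"
  proof (cases n)
    case 0
    then show ?thesis using assms
      by (simp add: catalan_mean_add catalan_mean_const catalan_mean_mult_x continuous_intros)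
  next
    case (Suc k)
    have "shift_op (atom_vec \<psi> c) n = catalan_mean (\<lambda>x. (1 - x) * \<psi> x * x ^ Suc k) + m * gap k"
      using Suc atom_vec_1[of \<psi> c] by (simp add: m_def)
    also have "\<dots> = catalan_mean (\<lambda>x. (1 - x) * \<psi> x * x ^ Suc k + m * ((1 - x) * x ^ k))"
      using assms by (subst catalan_mean_add) (auto intro!: continuous_intros simp: catalan_mean_cmult catalan_gap)
    also have "\<dots> = atom_vec (\<lambda>x. x * \<psi> x + m) 0 n"
      using Suc by (simp add: algebra_simps)
    finally show ?thesis by (simp add: m_def)
  qed
qed

lemma thin_atom_vec: "thin_op a (atom_vec \<psi> c) = atom_vec \<psi> (c + (1 - a) * (catalan_slope \<psi> - c))"
proof
  fix n show "thin_op a (atom_vec \<psi> c) n = atom_vec \<psi> (c + (1 - a) * (catalan_slope \<psi> - c)) n"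
    using atom_vec_1[of \<psi> c] by (cases n) (auto simp: algebra_simps catalan_slope_def)
qed

lemma catalan_slope_one: "catalan_slope (\<lambda>_. 1) = 3/4"
  using catalan_gap[of 0] by (simp add: catalan_slope_def gap_0)

text \<open>\<open>g\<close> accumulates the thinnings since the last shift: in the first family the
  entry at age 0 is \<open>g * catalan_slope \<psi>\<close>. The second family is
  \<open>defect\<close> before its first shift, with entry \<open>- g/4\<close> at age 0.\<close>

definition good_vec :: "(nat \<Rightarrow> real) \<Rightarrow> bool" where
  "good_vec v \<longleftrightarrow> (\<exists>\<psi> g. 0 \<le> g \<and> g \<le> 1 \<and>
     (\<psi> \<in> good_cone \<and> v = atom_vec \<psi> ((1 - g) * catalan_slope \<psi>) \<or>
      v = atom_vec (\<lambda>_. 1) (3/4 + g/4)))"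

text \<open>A shift preserves the total and absorbs the atom into the density, so the total is a
  mean over the cone. The second family is sent to \<open>x - g/4\<close>, of mean
  \<open>(1 - g)/4\<close>; at \<open>g = 1\<close> nothing is to spare.\<close>

lemma good_vec_shift:
  assumes "good_vec v" shows "good_vec (shift_op v)" and "0 \<le> v 0"
proof -
  from assms obtain \<psi> g where g: "0 \<le> g" "g \<le> 1"
    and d: "\<psi> \<in> good_cone \<and> v = atom_vec \<psi> ((1 - g) * catalan_slope \<psi>) \<or> v = atom_vec (\<lambda>_. 1) (3/4 + g/4)"
    unfolding good_vec_def by blast
  have "\<exists>\<phi>. \<phi> \<in> good_cone \<and> shift_op v = atom_vec \<phi> 0"
  proof (cases "v = atom_vec (\<lambda>_. 1) (3/4 + g/4)")
    case True
    have "(\<lambda>x. x + (- g/4)) \<in> good_cone"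
    proof (rule good_cone_rises)
      have "catalan_mean (\<lambda>x. x + (- g/4)) = 1/4 - g/4"
        using catalan_moment[of 1] by (subst catalan_mean_add) (auto intro!: continuous_intros simp: catalan_mean_const)
      then show "0 \<le> catalan_mean (\<lambda>x. x + (- g/4))" using g by simp
    qed (auto simp: rises_def intro!: continuous_intros)
    then show ?thesis unfolding True by (subst shift_atom_vec) (auto simp: catalan_slope_one)
  next
    case False
    then have p: "\<psi> \<in> good_cone" and v: "v = atom_vec \<psi> ((1 - g) * catalan_slope \<psi>)" using d by auto
    have "catalan_slope \<psi> - (1 - g) * catalan_slope \<psi> = g * catalan_slope \<psi>" by (simp add: algebra_simps)
    then show ?thesis using good_cone_step[OF p g] unfolding v shift_atom_vec[OF good_cone_cont[OF p]] by auto
  qed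
  then obtain \<phi> where \<phi>: "\<phi> \<in> good_cone" "shift_op v = atom_vec \<phi> 0" by blast
  then show "good_vec (shift_op v)" unfolding good_vec_def
    by (intro exI[of _ \<phi>] exI[of _ 1]) auto
  have "v 0 = shift_op v 0" by simp
  also have "\<dots> = catalan_mean \<phi>" using \<phi> by simp
  finally show "0 \<le> v 0" using good_cone_mean_nonneg[OF \<phi>(1)] by simp
qed

lemma good_vec_thin:
  assumes "good_vec v" "0 \<le> a" "a \<le> 1" shows "good_vec (thin_op a v)"
proof -
  from assms obtain \<psi> g where g: "0 \<le> g" "g \<le> 1"
    and d: "\<psi> \<in> good_cone \<and> v = atom_vec \<psi> ((1 - g) * catalan_slope \<psi>) \<or> v = atom_vec (\<lambda>_. 1) (3/4 + g/4)"
    unfolding good_vec_def by blast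
  have ag: "0 \<le> a * g" "a * g \<le> 1" using g assms by (auto simp: mult_le_one)
  from d have "\<psi> \<in> good_cone \<and> thin_op a v = atom_vec \<psi> ((1 - a * g) * catalan_slope \<psi>) \<or>
      thin_op a v = atom_vec (\<lambda>_. 1) (3/4 + (a * g)/4)"
  proof
    assume *: "\<psi> \<in> good_cone \<and> v = atom_vec \<psi> ((1 - g) * catalan_slope \<psi>)"
    have e: "(1 - g) * s + (1 - a) * (s - (1 - g) * s) = (1 - a * g) * s" for s :: real
      by (simp add: algebra_simps)
    show ?thesis using * by (simp add: thin_atom_vec e)
  next
    assume *: "v = atom_vec (\<lambda>_. 1) (3/4 + g/4)"
    have e: "3/4 + g/4 + (1 - a) * (3/4 - (3/4 + g/4)) = 3/4 + (a * g)/4"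
      by (simp add: field_simps)
    show ?thesis using * by (simp only: thin_atom_vec catalan_slope_one e) simp
  qed
  then show ?thesis unfolding good_vec_def using ag by blast
qed

lemma defect_eq: "defect = atom_vec (\<lambda>_. 1) 1"
proof
  fix n show "defect n = atom_vec (\<lambda>_. 1) 1 n"
    by (cases n) (auto simp: catalan_mean_const catalan_gap)
qed

lemma word_op_defect_nonneg: "0 \<le> word_op bs defect 0"
proof -
  have "good_vec (word_op bs defect)"
  proof (induction bs)
    case Nil
    show ?case unfolding good_vec_def defect_eq word_op.simps
      by (intro exI[of _ undefined] exI[of _ 1]) simp
  next
    case (Cons b bs)
    then show ?case by (auto simp: bond_op_def intro!: good_vec_thin good_vec_shift(1))
  qed
  then show ?thesis by (rule good_vec_shift)
qed

text \<open>The last letter is moved from the word to the marks. An occupied site costs nothing; an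
  empty one costs a product of two nonnegative numbers, from \<open>lift_avoid_le\<close> for the
  sites already moved and from \<open>word_op_defect_nonneg\<close> for the letters still to
  come.\<close>

lemma word_op_lift_le:
  "word_op as (lift (avoid (map site_factor bs))) 0 \<le> 2 * arcsine_mean (avoid (map site_factor (as @ bs)))"
proof (induction as arbitrary: bs rule: rev_induct)
  case Nil
  then show ?case by simp
next
  case (snoc b as)
  define \<phi> where "\<phi> = avoid (map site_factor bs)"
  have c: "cont01 \<phi>" by (auto simp: \<phi>_def intro!: continuous_intros)
  have IH: "word_op as (lift (avoid (map site_factor (b # bs)))) 0
      \<le> 2 * arcsine_mean (avoid (map site_factor ((as @ [b]) @ bs)))"
    using snoc.IH[of "b # bs"] by (simp only: append_assoc append_Cons append_Nil)
  show ?case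
  proof (cases b)
    case True
    then have "avoid (map site_factor (b # bs)) = (\<lambda>x. x * \<phi> x)" by (auto simp: \<phi>_def)
    then show ?thesis using IH True bond_op_lift[OF c] by (simp add: word_op_append \<phi>_def)
  next
    case False
    then have e: "avoid (map site_factor (b # bs)) = (\<lambda>x. x * \<phi> x + catalan_mean \<phi> * (1 - x))"
      by (auto simp: \<phi>_def)
    define A where "A = 2/3 * (catalan_mean \<phi> - lift \<phi> 1)"
    have A: "A \<ge> 0" using lift_avoid_le[of bs] by (simp add: A_def \<phi>_def)
    have "lift (avoid (map site_factor (b # bs))) = (\<lambda>n. shift_op (lift \<phi>) n + A * defect n)"
      unfolding e using lift_shift[OF c] by (auto simp: A_def)
    then have "word_op as (lift (avoid (map site_factor (b # bs)))) 0
        = word_op as (shift_op (lift \<phi>)) 0 + A * word_op as defect 0"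
      by (simp add: word_op_lin)
    then have "word_op as (shift_op (lift \<phi>)) 0 \<le> word_op as (lift (avoid (map site_factor (b # bs)))) 0"
      using mult_nonneg_nonneg[OF A word_op_defect_nonneg[of as]] by linarith
    then show ?thesis using IH False by (simp add: word_op_append \<phi>_def)
  qed
qed

text \<open>The factors of the next level: \<open>a\<close> for each bond from an occupied site.\<close>

fun next_factors :: "real \<Rightarrow> real \<Rightarrow> bool list \<Rightarrow> real list" where
  "next_factors a c [] = [c]"
| "next_factors a c (b # bs) = (c * (if b then a else 1)) # next_factors a (if b then a else 1) bs"

fun moment_vec :: "(real \<Rightarrow> real) \<Rightarrow> nat \<Rightarrow> real" where
  "moment_vec \<phi> 0 = 2 * arcsine_mean \<phi>"
| "moment_vec \<phi> (Suc k) = catalan_mean (\<lambda>x. \<phi> x * x ^ k)"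

lemma thin_thin: "thin_op a (thin_op b v) = thin_op (a * b) v"
proof
  fix n show "thin_op a (thin_op b v) n = thin_op (a * b) v n" by (cases n) (auto simp: algebra_simps)
qed

lemma thin_1: "thin_op 1 v = v"
proof
  fix n show "thin_op 1 v n = v n" by (cases n) auto
qed

lemma moment_vec_step:
  assumes "cont01 \<phi>"
  shows "shift_op (thin_op c (moment_vec \<phi>)) = moment_vec (\<lambda>x. x * \<phi> x + c * catalan_mean \<phi> * (1 - x))"
proof
  fix n
  define m where "m = c * catalan_mean \<phi>"
  show "shift_op (thin_op c (moment_vec \<phi>)) n = moment_vec (\<lambda>x. x * \<phi> x + c * catalan_mean \<phi> * (1 - x)) n"
    unfolding m_def[symmetric]
  proof (cases n)
    case 0
    have "2 * arcsine_mean (\<lambda>x. x * \<phi> x + m * (1 - x)) = 2 * arcsine_mean \<phi> - catalan_mean \<phi> + 2 * (m * arcsine_mean (\<lambda>x. 1 - x))"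
      using assms arcsine_mean_mult_x[OF assms]
      by (subst arcsine_mean_add) (auto intro!: continuous_intros simp: arcsine_mean_cmult)
    also have "arcsine_mean (\<lambda>x. 1 - x) = 1/2"
      using arcsine_moment[of 1] by (subst arcsine_mean_diff) (auto intro!: continuous_intros simp: arcsine_mean_const)
    finally show "shift_op (thin_op c (moment_vec \<phi>)) n = moment_vec (\<lambda>x. x * \<phi> x + m * (1 - x)) n"
      using 0 by (simp add: m_def algebra_simps)
  next
    case (Suc k)
    have "catalan_mean (\<lambda>x. (x * \<phi> x + m * (1 - x)) * x ^ k) = catalan_mean (\<lambda>x. \<phi> x * x ^ Suc k + m * ((1 - x) * x ^ k))"
      by (rule catalan_mean_cong) (simp add: algebra_simps)
    also have "\<dots> = catalan_mean (\<lambda>x. \<phi> x * x ^ Suc k) + m * gap k"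
      using assms by (subst catalan_mean_add) (auto intro!: continuous_intros simp: catalan_mean_cmult catalan_gap)
    finally show "shift_op (thin_op c (moment_vec \<phi>)) n = moment_vec (\<lambda>x. x * \<phi> x + m * (1 - x)) n"
      using Suc by (simp add: m_def)
  qed
qed

lemma moment_vec_one: "moment_vec (\<lambda>_. 1) = renewal"
proof
  fix n show "moment_vec (\<lambda>_. 1) n = renewal n" by (cases n) (auto simp: arcsine_mean_const catalan_moment)
qed

text \<open>\<open>bond_op\<close> groups the thinnings by the sending site; here they are regrouped
  by the receiving site. The carry \<open>c\<close> is the factor of the bond arriving from the
  preceding site and merges with the next thinning by \<open>thin_thin\<close>.\<close>

lemma word_op_next_factors:
  "shift_op (thin_op c (word_op bs renewal)) = moment_vec (avoid (next_factors (1/3) c bs))"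
proof (induction bs arbitrary: c)
  case Nil
  have "avoid [c] = (\<lambda>x. x * 1 + c * catalan_mean (\<lambda>_. 1) * (1 - x))"
    using catalan_mean_cong[of "avoid []" "\<lambda>_. 1"] by auto
  then show ?case using moment_vec_step[of "\<lambda>_. 1" c] by (simp add: moment_vec_one continuous_intros)
next
  case (Cons b bs)
  define a where "a = (if b then 1/3 else 1::real)"
  have "thin_op c (word_op (b # bs) renewal) = thin_op (c * a) (shift_op (thin_op a (word_op bs renewal)))"
    by (simp add: a_def bond_op_def thin_thin thin_1)
  also have "shift_op (thin_op a (word_op bs renewal)) = moment_vec (avoid (next_factors (1/3) a bs))"
    by (rule Cons.IH)
  finally have "shift_op (thin_op c (word_op (b # bs) renewal))
     = shift_op (thin_op (c * a) (moment_vec (avoid (next_factors (1/3) a bs))))" by simp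
  also have "\<dots> = moment_vec (avoid ((c * a) # next_factors (1/3) a bs))"
  proof -
    have "avoid ((c * a) # cs) = (\<lambda>x. x * avoid cs x + c * a * catalan_mean (avoid cs) * (1 - x))" for cs
      by auto
    then show ?thesis by (subst moment_vec_step) (auto intro!: continuous_intros simp del: avoid.simps)
  qed
  finally show ?case by (simp only: a_def next_factors.simps)
qed

lemma next_factors_mono:
  "0 \<le> a \<Longrightarrow> a \<le> a' \<Longrightarrow> 0 \<le> c \<Longrightarrow> c \<le> c' \<Longrightarrow>
    list_all2 (\<lambda>x y. 0 \<le> x \<and> x \<le> y) (next_factors a c bs) (next_factors a' c' bs)"
  by (induction bs arbitrary: c c') (auto intro!: mult_mono)

theorem avoid_supermartingale:
  assumes "0 \<le> a" "a \<le> 1/3"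
  shows "arcsine_mean (avoid (next_factors a 1 bs)) \<le> arcsine_mean (avoid (map site_factor bs))"
proof -
  have "arcsine_mean (avoid (next_factors a 1 bs)) \<le> arcsine_mean (avoid (next_factors (1/3) 1 bs))"
    by (rule arcsine_mean_mono) (auto intro!: continuous_intros avoid_mono next_factors_mono assms)
  also have "2 * \<dots> = word_op bs renewal 0"
    using fun_cong[OF word_op_next_factors[of 1 bs], of 0] by (simp add: thin_1)
  also have "word_op bs renewal 0 \<le> 2 * arcsine_mean (avoid (map site_factor bs))"
  proof -
    have "avoid (map site_factor []) = (\<lambda>_. 1)" by auto
    then show ?thesis using word_op_lift_le[of bs "[]"] by (simp add: lift_one)
  qed
  finally show ?thesis by simp
qed

section \<open>Bernoulli percolation on finite edge sets\<close>

definition bern :: "real \<Rightarrow> 'e set \<Rightarrow> ('e set \<Rightarrow> real) \<Rightarrow> real" where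
  "bern p E f = (\<Sum>S\<in>Pow E. p ^ card S * (1 - p) ^ card (E - S) * f S)"

lemma bern_empty [simp]: "bern p {} f = f {}"
  by (simp add: bern_def)

lemma bern_insert:
  assumes "finite E" "e \<notin> E"
  shows "bern p (insert e E) f = p * bern p E (\<lambda>S. f (insert e S)) + (1 - p) * bern p E f"
proof -
  have inj: "inj_on (insert e) (Pow E)"
    using assms(2) by (auto simp: inj_on_def)
  have disj: "Pow E \<inter> insert e ` Pow E = {}" using assms(2) by auto
  have "bern p (insert e E) f
      = (\<Sum>S\<in>Pow E. p ^ card S * (1 - p) ^ card (insert e E - S) * f S)
      + (\<Sum>S\<in>insert e ` Pow E. p ^ card S * (1 - p) ^ card (insert e E - S) * f S)"
    unfolding bern_def Pow_insert using assms disj by (subst sum.union_disjoint) auto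
  also have "(\<Sum>S\<in>Pow E. p ^ card S * (1 - p) ^ card (insert e E - S) * f S) = (1 - p) * bern p E f"
    unfolding bern_def sum_distrib_left
  proof (rule sum.cong)
    fix S assume S: "S \<in> Pow E"
    then have "insert e E - S = insert e (E - S)" using assms(2) by auto
    then have "card (insert e E - S) = Suc (card (E - S))" using assms by (simp add: finite_subset)
    then show "p ^ card S * (1 - p) ^ card (insert e E - S) * f S
        = (1 - p) * (p ^ card S * (1 - p) ^ card (E - S) * f S)" by simp
  qed simp
  also have "(\<Sum>S\<in>insert e ` Pow E. p ^ card S * (1 - p) ^ card (insert e E - S) * f S)
      = p * bern p E (\<lambda>S. f (insert e S))"
    unfolding bern_def sum_distrib_left sum.reindex[OF inj] o_def
  proof (rule sum.cong)
    fix S assume S: "S \<in> Pow E"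
    then have "insert e E - insert e S = E - S" using assms(2) by auto
    moreover have "card (insert e S) = Suc (card S)" using S assms by (subst card_insert_disjoint) (auto intro: finite_subset)
    ultimately show "p ^ card (insert e S) * (1 - p) ^ card (insert e E - insert e S) * f (insert e S)
        = p * (p ^ card S * (1 - p) ^ card (E - S) * f (insert e S))" by simp
  qed simp
  finally show ?thesis by simp
qed

lemma bern_cong: "(\<And>S. S \<subseteq> E \<Longrightarrow> f S = g S) \<Longrightarrow> bern p E f = bern p E g"
  unfolding bern_def by (rule sum.cong) auto

lemma bern_add: "bern p E (\<lambda>S. f S + g S) = bern p E f + bern p E g"
  unfolding bern_def by (simp add: algebra_simps sum.distrib)

lemma bern_cmult: "bern p E (\<lambda>S. c * f S) = c * bern p E f"
  unfolding bern_def by (simp add: sum_distrib_left mult_ac)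

lemma bern_mono:
  assumes "0 \<le> p" "p \<le> 1" "\<And>S. S \<subseteq> E \<Longrightarrow> f S \<le> g S"
  shows "bern p E f \<le> bern p E g"
  unfolding bern_def by (rule sum_mono) (use assms in \<open>auto intro!: mult_left_mono\<close>)

lemma bern_const: "finite E \<Longrightarrow> bern p E (\<lambda>_. c) = c"
  by (induction E rule: finite_induct) (auto simp: bern_insert algebra_simps)

lemma bern_Un:
  assumes "finite A" "finite B" "A \<inter> B = {}"
  shows "bern p (A \<union> B) f = bern p A (\<lambda>S. bern p B (\<lambda>T. f (S \<union> T)))"
  using assms(1,3)
proof (induction A arbitrary: f rule: finite_induct)
  case (insert e A)
  then show ?case using assms(2) by (simp add: bern_insert)
qed simp

lemma bern_restrict:
  assumes "finite E" "A \<subseteq> E" "\<And>S. S \<subseteq> E \<Longrightarrow> f S = f (S \<inter> A)"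
  shows "bern p E f = bern p A f"
proof -
  have fin: "finite A" "finite (E - A)" using assms finite_subset by auto
  have "bern p E f = bern p (A \<union> (E - A)) f" using assms(2) by (simp add: Un_absorb1)
  also have "\<dots> = bern p A (\<lambda>S. bern p (E - A) (\<lambda>T. f (S \<union> T)))"
    using fin by (intro bern_Un) auto
  also have "\<dots> = bern p A (\<lambda>S. bern p (E - A) (\<lambda>T. f S))"
  proof (intro bern_cong)
    fix S T assume "S \<subseteq> A" "T \<subseteq> E - A"
    then have "S \<union> T \<subseteq> E" and "(S \<union> T) \<inter> A = S" using assms(2) by auto
    then show "f (S \<union> T) = f S" using assms(3)[of "S \<union> T"] by metis
  qed
  finally show ?thesis using fin by (simp add: bern_const)
qed

lemma bern_image:
  assumes "finite E" "inj_on h E"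
  shows "bern p (h ` E) f = bern p E (\<lambda>S. f (h ` S))"
  using assms
proof (induction E arbitrary: f rule: finite_induct)
  case (insert e E)
  then have "h e \<notin> h ` E" by (auto simp: inj_on_def)
  then show ?case using insert by (simp add: bern_insert)
qed simp

text \<open>Induction on the edges: the conditional means given the new edge increase with its
  state, so that edge contributes the covariance \<open>p * (1 - p) * ((b - a) * (d - c))\<close>,
  which is nonnegative.\<close>

lemma harris_inequality:
  assumes "finite E" "0 \<le> p" "p \<le> 1" "mono_on (Pow E) f" "mono_on (Pow E) g"
  shows "bern p E f * bern p E g \<le> bern p E (\<lambda>S. f S * g S)"
  using assms(1,4,5)
proof (induction E arbitrary: f g rule: finite_induct)
  case (insert e E)
  define f1 g1 where "f1 = (\<lambda>S. f (insert e S))" and "g1 = (\<lambda>S. g (insert e S))"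
  have m: "mono_on (Pow E) f" "mono_on (Pow E) g" "mono_on (Pow E) f1" "mono_on (Pow E) g1"
    using insert.prems by (auto simp: mono_on_def f1_def g1_def subset_insertI2 insert_mono)
  have le: "bern p E f \<le> bern p E f1" "bern p E g \<le> bern p E g1"
    unfolding f1_def g1_def using insert.prems assms
    by (auto intro!: bern_mono simp: mono_on_def subset_insertI subset_insertI2)
  define a b c d where "a = bern p E f" "b = bern p E f1" "c = bern p E g" "d = bern p E g1"
  have "0 \<le> p * (1 - p) * ((b - a) * (d - c))"
    using le assms by (intro mult_nonneg_nonneg) (auto simp: a_b_c_d_def)
  then have "(p * b + (1 - p) * a) * (p * d + (1 - p) * c) \<le> p * (b * d) + (1 - p) * (a * c)"
    by (simp add: algebra_simps)
  also have "\<dots> \<le> p * bern p E (\<lambda>S. f1 S * g1 S) + (1 - p) * bern p E (\<lambda>S. f S * g S)"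
    unfolding a_b_c_d_def using assms m by (intro add_mono mult_left_mono insert.IH) auto
  finally show ?case
    using insert.hyps by (simp add: bern_insert f1_def g1_def a_b_c_d_def)
qed simp

lemma cont01_bern:
  "finite E \<Longrightarrow> (\<And>S. S \<subseteq> E \<Longrightarrow> cont01 (g S)) \<Longrightarrow> cont01 (\<lambda>x. bern p E (\<lambda>S. g S x))"
  unfolding bern_def by (intro continuous_intros) auto

lemma catalan_mean_bern:
  assumes "finite E" "\<And>S. cont01 (g S)"
  shows "bern p E (\<lambda>S. catalan_mean (g S)) = catalan_mean (\<lambda>x. bern p E (\<lambda>S. g S x))"
  using assms
proof (induction E arbitrary: g rule: finite_induct)
  case (insert e E)
  have c: "cont01 (\<lambda>x. bern p E (\<lambda>S. g (insert e S) x))" "cont01 (\<lambda>x. bern p E (\<lambda>S. g S x))"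
    using insert by (auto intro!: cont01_bern)
  show ?case using insert c
    by (simp add: bern_insert) (subst catalan_mean_add, auto intro!: continuous_intros simp: catalan_mean_cmult)
qed simp

lemma arcsine_mean_bern:
  assumes "finite E" "\<And>S. cont01 (g S)"
  shows "bern p E (\<lambda>S. arcsine_mean (g S)) = arcsine_mean (\<lambda>x. bern p E (\<lambda>S. g S x))"
  using assms
proof (induction E arbitrary: g rule: finite_induct)
  case (insert e E)
  have c: "cont01 (\<lambda>x. bern p E (\<lambda>S. g (insert e S) x))" "cont01 (\<lambda>x. bern p E (\<lambda>S. g S x))"
    using insert by (auto intro!: cont01_bern)
  show ?case using insert c
    by (simp add: bern_insert) (subst arcsine_mean_add, auto intro!: continuous_intros simp: arcsine_mean_cmult)
qed simp

section \<open>Survival of oriented percolation\<close>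

text \<open>The vertices \<open>(x, y)\<close> with \<open>x + y = n\<close> form level \<open>n\<close> and are indexed by \<open>x\<close>.\<close>

definition site :: "nat \<Rightarrow> nat \<Rightarrow> vertex" where
  "site n x = (int x, int n - int x)"

definition up_edge :: "nat \<Rightarrow> nat \<Rightarrow> vertex set" where
  "up_edge n x = {site n x, site (Suc n) x}"

definition right_edge :: "nat \<Rightarrow> nat \<Rightarrow> vertex set" where
  "right_edge n x = {site n x, site (Suc n) (Suc x)}"

lemma edge_inject:
  "up_edge n x = up_edge m y \<longleftrightarrow> n = m \<and> x = y"
  "right_edge n x = right_edge m y \<longleftrightarrow> n = m \<and> x = y"
  "up_edge n x \<noteq> right_edge m y" "right_edge m y \<noteq> up_edge n x"
  by (auto simp: up_edge_def right_edge_def site_def doubleton_eq_iff)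

fun occ :: "vertex set set \<Rightarrow> nat \<Rightarrow> nat \<Rightarrow> bool" where
  "occ S 0 x \<longleftrightarrow> x = 0"
| "occ S (Suc n) x \<longleftrightarrow> occ S n x \<and> up_edge n x \<in> S \<or>
     (\<exists>y. x = Suc y \<and> occ S n y \<and> right_edge n y \<in> S)"

lemma occ_le: "occ S n x \<Longrightarrow> x \<le> n"
  by (induction n arbitrary: x) fastforce+

definition status :: "vertex set set \<Rightarrow> nat \<Rightarrow> bool list" where
  "status S n = map (occ S n) [0..<Suc n]"

text \<open>A scan along one level, parallel to \<open>next_factors\<close>: \<open>pv\<close> tells
  whether the current position is reached by the right edge of the preceding site.\<close>

fun next_status :: "vertex set set \<Rightarrow> nat \<Rightarrow> nat \<Rightarrow> bool \<Rightarrow> bool list \<Rightarrow> bool list" where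
  "next_status S n x pv [] = [pv]"
| "next_status S n x pv (b # bs) =
     (pv \<or> b \<and> up_edge n x \<in> S) # next_status S n (Suc x) (b \<and> right_edge n x \<in> S) bs"

lemma length_next_status: "length (next_status S n x pv bs) = Suc (length bs)"
  by (induction bs arbitrary: x pv) auto

lemma nth_next_status:
  "i \<le> length bs \<Longrightarrow> next_status S n x pv bs ! i \<longleftrightarrow>
     (i < length bs \<and> bs ! i \<and> up_edge n (x + i) \<in> S) \<or>
     (case i of 0 \<Rightarrow> pv | Suc j \<Rightarrow> bs ! j \<and> right_edge n (x + j) \<in> S)"
proof (induction bs arbitrary: x pv i)
  case (Cons b bs)
  then show ?case
    by (cases i) (auto split: nat.splits)
qed auto

lemma status_Suc: "status S (Suc n) = next_status S n 0 False (status S n)"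
proof (rule nth_equalityI)
  show "length (status S (Suc n)) = length (next_status S n 0 False (status S n))"
    by (simp add: length_next_status status_def)
next
  fix i assume "i < length (status S (Suc n))"
  then have i: "i \<le> Suc n" by (simp add: status_def)
  have nth: "j \<le> n \<Longrightarrow> status S n ! j = occ S n j" for j
    by (simp add: status_def nth_append del: upt_Suc)
  have "status S (Suc n) ! i = occ S (Suc n) i" using i by (simp add: status_def del: upt_Suc)
  also have "\<dots> \<longleftrightarrow> next_status S n 0 False (status S n) ! i"
  proof -
    have len: "length (status S n) = Suc n" by (simp add: status_def)
    have "occ S n i \<longleftrightarrow> i < Suc n \<and> status S n ! i"
      using nth[of i] occ_le[of S n i] by auto
    then show ?thesis using i len nth by (subst nth_next_status) (auto split: nat.splits)
  qed
  finally show "status S (Suc n) ! i = next_status S n 0 False (status S n) ! i" .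
qed

definition level_edges :: "nat \<Rightarrow> nat set \<Rightarrow> vertex set set" where
  "level_edges n Y = up_edge n ` Y \<union> right_edge n ` Y"

lemma finite_level_edges [simp]: "finite Y \<Longrightarrow> finite (level_edges n Y)"
  by (simp add: level_edges_def)

lemma next_status_cong:
  assumes "S \<inter> level_edges n {x..<x + length bs} = T \<inter> level_edges n {x..<x + length bs}"
  shows "next_status S n x pv bs = next_status T n x pv bs"
  using assms
proof (induction bs arbitrary: x pv)
  case (Cons b bs)
  have "{x..<x + length (b # bs)} = insert x {Suc x..<Suc x + length bs}" by auto
  then have e: "level_edges n {x..<x + length (b # bs)}
     = insert (up_edge n x) (insert (right_edge n x) (level_edges n {Suc x..<Suc x + length bs}))"
    by (auto simp: level_edges_def)
  have "up_edge n x \<in> S \<longleftrightarrow> up_edge n x \<in> T" "right_edge n x \<in> S \<longleftrightarrow> right_edge n x \<in> T"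
    "S \<inter> level_edges n {Suc x..<Suc x + length bs} = T \<inter> level_edges n {Suc x..<Suc x + length bs}"
    using Cons.prems unfolding e by blast+
  then show ?case using Cons.IH by simp
qed simp

lemma next_factors_affine:
  "avoid (next_factors a (p * c + (1 - p) * d) bs) t
     = p * avoid (next_factors a c bs) t + (1 - p) * avoid (next_factors a d bs) t"
  by (cases bs) (auto simp: algebra_simps)

text \<open>Each edge leads into exactly one site of the next level, so given the present level the
  sites are reached independently. The right edge at \<open>x\<close> decides the carry, whose
  average is taken inside by \<open>next_factors_affine\<close>; the up edge at \<open>x\<close>
  affects only the head.\<close>

lemma bern_next_status:
  "bern p (level_edges n {x..<x + length bs}) (\<lambda>S. avoid (map site_factor (next_status S n x pv bs)) t)
     = avoid (next_factors (1 - p) (site_factor pv) bs) t"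
proof (induction bs arbitrary: x pv t)
  case Nil
  then show ?case by (simp add: level_edges_def)
next
  case (Cons b bs)
  define L where "L = level_edges n {Suc x..<Suc x + length bs}"
  define a where "a = (if b then 1 - p else 1)"
  have "{x..<x + length (b # bs)} = insert x {Suc x..<Suc x + length bs}" by auto
  then have e: "level_edges n {x..<x + length (b # bs)} = insert (up_edge n x) (insert (right_edge n x) L)"
    by (auto simp: level_edges_def L_def)
  have fin: "finite L" and nin: "up_edge n x \<notin> L" "right_edge n x \<notin> L"
    by (auto simp: L_def level_edges_def edge_inject)
  define R where "R S = avoid (map site_factor (next_status S n (Suc x) (b \<and> right_edge n x \<in> S) bs))" for S
  have cR: "cont01 (R S)" for S unfolding R_def by (intro continuous_intros)
  have R_up: "R (insert (up_edge n x) S) = R S" for S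
  proof -
    have "next_status (insert (up_edge n x) S) n (Suc x) pv' bs = next_status S n (Suc x) pv' bs" for pv'
      by (rule next_status_cong) (use nin in \<open>auto simp: L_def\<close>)
    then show ?thesis by (simp add: R_def edge_inject)
  qed
  have ER: "bern p (insert (right_edge n x) L) (\<lambda>S. R S t') = avoid (next_factors (1 - p) a bs) t'" for t'
  proof -
    have "next_status (insert (right_edge n x) S) n (Suc x) pv' bs = next_status S n (Suc x) pv' bs" for S pv'
      by (rule next_status_cong) (use nin in \<open>auto simp: L_def\<close>)
    then have 1: "R (insert (right_edge n x) S) = avoid (map site_factor (next_status S n (Suc x) b bs))" for S
      by (simp add: R_def)
    have 2: "S \<subseteq> L \<Longrightarrow> R S = avoid (map site_factor (next_status S n (Suc x) False bs))" for S
    proof -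
      assume "S \<subseteq> L"
      then have "right_edge n x \<notin> S" using nin by auto
      then show ?thesis by (simp add: R_def)
    qed
    have "bern p L (\<lambda>S. R S t') = bern p L (\<lambda>S. avoid (map site_factor (next_status S n (Suc x) False bs)) t')"
      by (rule bern_cong) (simp only: 2)
    then have "bern p (insert (right_edge n x) L) (\<lambda>S. R S t')
        = p * avoid (next_factors (1 - p) (site_factor b) bs) t' + (1 - p) * avoid (next_factors (1 - p) (site_factor False) bs) t'"
      unfolding bern_insert[OF fin nin(2)] 1 by (simp only: Cons.IH[of "Suc x", folded L_def])
    also have "\<dots> = avoid (next_factors (1 - p) (p * site_factor b + (1 - p) * site_factor False) bs) t'"
      by (rule next_factors_affine[symmetric])
    also have "p * site_factor b + (1 - p) * site_factor False = a" by (simp add: a_def)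
    finally show ?thesis .
  qed
  define E where "E = insert (right_edge n x) L"
  have finE: "finite E" and ninE: "up_edge n x \<notin> E" using fin nin by (auto simp: E_def edge_inject)
  define c where "c = site_factor pv"
  have U: "avoid (map site_factor (next_status S n x pv (b # bs))) t
      = t * R S t + site_factor (pv \<or> b \<and> up_edge n x \<in> S) * catalan_mean (R S) * (1 - t)" for S
    by (simp add: R_def)
  have EE: "bern p E (\<lambda>S. t * R S t + k * catalan_mean (R S) * (1 - t))
     = t * avoid (next_factors (1 - p) a bs) t + k * catalan_mean (avoid (next_factors (1 - p) a bs)) * (1 - t)" for k
  proof -
    have "bern p E (\<lambda>S. t * R S t + (k * (1 - t)) * catalan_mean (R S))
      = t * bern p E (\<lambda>S. R S t) + (k * (1 - t)) * catalan_mean (\<lambda>x. bern p E (\<lambda>S. R S x))"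
      unfolding bern_add bern_cmult catalan_mean_bern[OF finE cR] ..
    then show ?thesis unfolding ER[folded E_def] by (simp add: mult_ac)
  qed
  have "bern p (insert (up_edge n x) E) (\<lambda>S. avoid (map site_factor (next_status S n x pv (b # bs))) t)
      = p * bern p E (\<lambda>S. t * R S t + site_factor (pv \<or> b) * catalan_mean (R S) * (1 - t))
      + (1 - p) * bern p E (\<lambda>S. t * R S t + c * catalan_mean (R S) * (1 - t))"
  proof -
    have "bern p E (\<lambda>S. t * R S t + site_factor (pv \<or> b \<and> up_edge n x \<in> S) * catalan_mean (R S) * (1 - t))
        = bern p E (\<lambda>S. t * R S t + c * catalan_mean (R S) * (1 - t))"
      using ninE by (intro bern_cong) (auto simp: c_def)
    then show ?thesis unfolding U bern_insert[OF finE ninE] R_up by simp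
  qed
  also have "\<dots> = t * avoid (next_factors (1 - p) a bs) t
      + (p * site_factor (pv \<or> b) + (1 - p) * c) * catalan_mean (avoid (next_factors (1 - p) a bs)) * (1 - t)"
    unfolding EE by (simp add: algebra_simps)
  also have "p * site_factor (pv \<or> b) + (1 - p) * c = c * a" by (auto simp: a_def c_def)
  finally show ?case unfolding e E_def c_def by (simp add: a_def)
qed

section \<open>Survival up to a given level\<close>

definition cone_edges :: "nat \<Rightarrow> vertex set set" where
  "cone_edges n = (\<Union>k<n. level_edges k {..k})"

lemma finite_cone_edges [simp]: "finite (cone_edges n)"
  by (simp add: cone_edges_def)

lemma cone_edges_Suc: "cone_edges (Suc n) = cone_edges n \<union> level_edges n {..n}"
  by (auto simp: cone_edges_def lessThan_Suc)

lemma cone_level_disjoint: "cone_edges n \<inter> level_edges n Y = {}"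
  by (auto simp: cone_edges_def level_edges_def edge_inject)

lemma occ_cong:
  "S \<inter> cone_edges n = T \<inter> cone_edges n \<Longrightarrow> occ S n x = occ T n x"
proof (induction n arbitrary: x)
  case (Suc n)
  have IH: "occ S n y = occ T n y" for y
    using Suc.IH Suc.prems unfolding cone_edges_Suc by blast
  have "up_edge n y \<in> S \<longleftrightarrow> up_edge n y \<in> T" "right_edge n y \<in> S \<longleftrightarrow> right_edge n y \<in> T" if "y \<le> n" for y
    using Suc.prems that unfolding cone_edges_Suc level_edges_def by blast+
  then show ?case using IH occ_le[of T n] by auto
qed simp

text \<open>An empty occupied set is avoided with probability 1, so \<open>h n\<close> bounds the
  probability of extinction; \<open>h 0\<close> is the chance that the stationary process, of mean
  gap 2, misses a given site.\<close>

lemma survival_probability: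
  assumes "2/3 \<le> p" "p \<le> 1"
  shows "1/2 \<le> bern p (cone_edges n) (\<lambda>S. of_bool (\<exists>x. occ S n x))"
proof -
  define h where "h n = bern p (cone_edges n) (\<lambda>S. arcsine_mean (avoid (map site_factor (status S n))))" for n
  have "h n \<le> 1/2" for n
  proof (induction n)
    case 0
    have "avoid [0] = (\<lambda>x. x ^ 1)" by auto
    then show ?case using arcsine_moment[of 1] by (simp add: h_def cone_edges_def status_def)
  next
    case (Suc n)
    have "h (Suc n) = bern p (cone_edges n) (\<lambda>S. bern p (level_edges n {..n}) (\<lambda>T.
        arcsine_mean (avoid (map site_factor (status (S \<union> T) (Suc n))))))"
      unfolding h_def cone_edges_Suc by (intro bern_Un) (auto simp: cone_level_disjoint)
    also have "\<dots> = bern p (cone_edges n) (\<lambda>S. bern p (level_edges n {..n}) (\<lambda>T.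
        arcsine_mean (avoid (map site_factor (next_status T n 0 False (status S n))))))"
    proof (intro bern_cong)
      fix S T assume S: "S \<subseteq> cone_edges n" and T: "T \<subseteq> level_edges n {..n}"
      have "occ (S \<union> T) n x = occ S n x" for x
        using S T cone_level_disjoint[of n "{..n}"] by (intro occ_cong) blast
      then have "status (S \<union> T) n = status S n" by (auto simp: status_def)
      moreover have "next_status (S \<union> T) n 0 False bs = next_status T n 0 False bs" for bs
        using S cone_level_disjoint[of n] by (intro next_status_cong) blast
      ultimately show "arcsine_mean (avoid (map site_factor (status (S \<union> T) (Suc n))))
          = arcsine_mean (avoid (map site_factor (next_status T n 0 False (status S n))))"
        by (simp add: status_Suc)
    qed
    also have "\<dots> = bern p (cone_edges n) (\<lambda>S. arcsine_mean (avoid (next_factors (1 - p) 1 (status S n))))"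
    proof (intro bern_cong)
      fix S
      have e: "{..n} = {0..<0 + length (status S n)}" by (auto simp: status_def)
      have "bern p (level_edges n {..n}) (\<lambda>T. avoid (map site_factor (next_status T n 0 False (status S n))) t)
          = avoid (next_factors (1 - p) 1 (status S n)) t" for t
        unfolding e bern_next_status by simp
      then show "bern p (level_edges n {..n}) (\<lambda>T. arcsine_mean (avoid (map site_factor (next_status T n 0 False (status S n)))))
          = arcsine_mean (avoid (next_factors (1 - p) 1 (status S n)))"
        by (subst arcsine_mean_bern) (auto intro!: continuous_intros)
    qed
    also have "\<dots> \<le> h n" unfolding h_def
      by (intro bern_mono avoid_supermartingale) (use assms in auto)
    finally show ?case using Suc by simp
  qed
  then have "h n \<le> 1/2" .
  moreover have "bern p (cone_edges n) (\<lambda>S. 1 + (-1) * of_bool (\<exists>x. occ S n x)) \<le> h n"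
    unfolding h_def
  proof (intro bern_mono)
    fix S
    show "1 + (-1) * of_bool (\<exists>x. occ S n x) \<le> arcsine_mean (avoid (map site_factor (status S n)))"
    proof (cases "\<exists>x. occ S n x")
      case True
      have "arcsine_mean (\<lambda>_. 0) \<le> arcsine_mean (avoid (map site_factor (status S n)))"
        by (intro arcsine_mean_mono avoid_nonneg) (auto intro!: continuous_intros)
      then show ?thesis using True by (simp add: arcsine_mean_const)
    next
      case False
      have "avoid (replicate k 1) x = 1" if "x \<in> {0..1}" for k and x :: real
        using that
      proof (induction k arbitrary: x)
        case (Suc k)
        then have "catalan_mean (avoid (replicate k 1)) = 1"
          using catalan_mean_cong[of "avoid (replicate k 1)" "\<lambda>_. 1"] by (simp add: catalan_mean_const)
        then show ?case using Suc by simp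
      qed simp
      then have "arcsine_mean (avoid (replicate k 1)) = 1" for k
        using arcsine_mean_cong[of "avoid (replicate k 1)" "\<lambda>_. 1"] by (simp add: arcsine_mean_const)
      moreover have "map site_factor (status S n) = replicate (Suc n) 1"
      proof (rule nth_equalityI)
        fix i assume "i < length (map site_factor (status S n))"
        then show "map site_factor (status S n) ! i = replicate (Suc n) 1 ! i"
          using False by (simp add: status_def del: upt_Suc replicate_Suc)
      qed (simp add: status_def)
      ultimately show ?thesis using False by (simp del: replicate_Suc)
    qed
  qed (use assms in auto)
  ultimately show ?thesis by (simp only: bern_add bern_cmult bern_const[OF finite_cone_edges])
qed

section \<open>Crossing oriented paths\<close>

text \<open>\<open>X i\<close> is the horizontal coordinate on level \<open>i\<close>, and
  \<open>i - X i\<close> the height.\<close>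

definition ne_path :: "vertex set set \<Rightarrow> nat \<Rightarrow> (nat \<Rightarrow> nat) \<Rightarrow> bool" where
  "ne_path S n X \<longleftrightarrow> X 0 = 0 \<and>
     (\<forall>i<n. X (Suc i) = X i \<and> up_edge i (X i) \<in> S \<or> X (Suc i) = Suc (X i) \<and> right_edge i (X i) \<in> S)"

lemma occ_imp_ne_path: "occ S n x \<Longrightarrow> \<exists>X. ne_path S n X \<and> X n = x"
proof (induction n arbitrary: x)
  case 0
  then show ?case by (intro exI[of _ "\<lambda>_. 0"]) (simp add: ne_path_def)
next
  case (Suc n)
  then obtain y where y: "occ S n y" "x = y \<and> up_edge n y \<in> S \<or> x = Suc y \<and> right_edge n y \<in> S"
    by auto
  from Suc.IH[OF y(1)] obtain X where X: "ne_path S n X" "X n = y" by blast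
  have "ne_path S (Suc n) (X(Suc n := x))"
    unfolding ne_path_def
  proof (intro conjI allI impI)
    fix i assume "i < Suc n"
    then consider "i < n" | "i = n" by linarith
    then show "(X(Suc n := x)) (Suc i) = (X(Suc n := x)) i \<and> up_edge i ((X(Suc n := x)) i) \<in> S \<or>
        (X(Suc n := x)) (Suc i) = Suc ((X(Suc n := x)) i) \<and> right_edge i ((X(Suc n := x)) i) \<in> S"
      using X y(2) by cases (auto simp: ne_path_def)
  qed (use X in \<open>simp add: ne_path_def\<close>)
  then show ?case by (metis fun_upd_same)
qed

lemma ne_path_step: "ne_path S n X \<Longrightarrow> i < n \<Longrightarrow> X (Suc i) = X i \<or> X (Suc i) = Suc (X i)"
  by (auto simp: ne_path_def)

lemma ne_path_le: "ne_path S n X \<Longrightarrow> i \<le> n \<Longrightarrow> X i \<le> i"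
proof (induction i)
  case (Suc i)
  then show ?case using ne_path_step[of S n X i] by auto
qed (simp add: ne_path_def)

lemma ne_path_mono_index:
  assumes "ne_path S n X" "i \<le> j" "j \<le> n"
  shows "X i \<le> X j \<and> i - X i \<le> j - X j"
  using assms(2,3)
proof (induction j rule: dec_induct)
  case (step j)
  then show ?case using ne_path_step[OF assms(1), of j] ne_path_le[OF assms(1), of j] by auto
qed simp

lemma ne_path_mono: "ne_path S n X \<Longrightarrow> S \<subseteq> T \<Longrightarrow> ne_path T n X"
  by (auto simp: ne_path_def)

lemma ne_path_restrict: "ne_path S n X \<Longrightarrow> ne_path (S \<inter> cone_edges n) n X"
proof -
  assume X: "ne_path S n X"
  have "up_edge i (X i) \<in> cone_edges n" "right_edge i (X i) \<in> cone_edges n" if "i < n" for i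
    using that ne_path_le[OF X, of i] by (auto simp: cone_edges_def level_edges_def)
  then show ?thesis using X unfolding ne_path_def by blast
qed

section \<open>Reflection in the diagonal\<close>

lemma image_site_swap: "x \<le> n \<Longrightarrow> prod.swap (site n x) = site n (n - x)"
  by (simp add: site_def)

lemma image_edge_swap:
  assumes "x \<le> n"
  shows "prod.swap ` up_edge n x = right_edge n (n - x)" "prod.swap ` right_edge n x = up_edge n (n - x)"
  using assms image_site_swap[of x n] image_site_swap[of x "Suc n"] image_site_swap[of "Suc x" "Suc n"]
  by (auto simp: up_edge_def right_edge_def Suc_diff_le)

lemma ne_path_swap:
  assumes "ne_path S n X"
  shows "ne_path ((`) prod.swap ` S) n (\<lambda>i. i - X i)"
  unfolding ne_path_def
proof (intro conjI allI impI)
  fix i assume i: "i < n"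
  then have le: "X i \<le> i" using ne_path_le[OF assms] by simp
  consider "X (Suc i) = X i" "up_edge i (X i) \<in> S" | "X (Suc i) = Suc (X i)" "right_edge i (X i) \<in> S"
    using assms i unfolding ne_path_def by blast
  then show "Suc i - X (Suc i) = i - X i \<and> up_edge i (i - X i) \<in> (`) prod.swap ` S \<or>
      Suc i - X (Suc i) = Suc (i - X i) \<and> right_edge i (i - X i) \<in> (`) prod.swap ` S"
  proof cases
    case 1
    then have "right_edge i (i - X i) \<in> (`) prod.swap ` S"
      using image_edge_swap(1)[OF le] by (metis image_eqI)
    then show ?thesis using 1 le by (simp add: Suc_diff_le)
  next
    case 2
    then have "up_edge i (i - X i) \<in> (`) prod.swap ` S"
      using image_edge_swap(2)[OF le] by (metis image_eqI)
    then show ?thesis using 2 by simp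
  qed
qed simp

lemma swap_swap_image: "(`) prod.swap ` (`) prod.swap ` S = (S :: vertex set set)"
  by (simp add: image_image)

lemma cone_edges_swap: "(`) prod.swap ` cone_edges n = cone_edges n"
proof -
  have sub: "(`) prod.swap ` cone_edges n \<subseteq> cone_edges n"
    by (auto simp: cone_edges_def level_edges_def image_edge_swap)
  then have "(`) prod.swap ` (`) prod.swap ` cone_edges n \<subseteq> (`) prod.swap ` cone_edges n" by (rule image_mono)
  with sub show ?thesis unfolding swap_swap_image by blast
qed

text \<open>Level \<open>2 * m\<close> meets the diagonal in \<open>(m, m)\<close>, so a low path
  has met the line \<open>x = m\<close> at height at most \<open>m\<close>. The levels up to
  \<open>4 * m\<close> leave it room to get past the mirrored path.\<close>

definition low_path :: "nat \<Rightarrow> vertex set set \<Rightarrow> bool" where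
  "low_path m S \<longleftrightarrow> (\<exists>X. ne_path S (4 * m) X \<and> m \<le> X (2 * m))"

definition high_path :: "nat \<Rightarrow> vertex set set \<Rightarrow> bool" where
  "high_path m S \<longleftrightarrow> (\<exists>X. ne_path S (4 * m) X \<and> X (2 * m) \<le> m)"

lemma low_imp_high: "low_path m S \<Longrightarrow> high_path m ((`) prod.swap ` S)"
  unfolding low_path_def high_path_def using ne_path_swap by fastforce

lemma high_imp_low: "high_path m S \<Longrightarrow> low_path m ((`) prod.swap ` S)"
  unfolding low_path_def high_path_def using ne_path_swap by fastforce

lemma low_swap: "low_path m ((`) prod.swap ` S) \<longleftrightarrow> high_path m S"
  using low_imp_high[of m "(`) prod.swap ` S"] high_imp_low[of m S] unfolding swap_swap_image by blast

lemma low_path_mono: "low_path m S \<Longrightarrow> S \<subseteq> T \<Longrightarrow> low_path m T"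
  unfolding low_path_def using ne_path_mono by blast

lemma low_path_restrict: "low_path m S \<longleftrightarrow> low_path m (S \<inter> cone_edges (4 * m))"
  unfolding low_path_def using ne_path_mono ne_path_restrict by (metis inf_le1)

text \<open>A surviving path is low or high, and swapping the coordinates exchanges the two events;
  each gets half of the survival bound.\<close>

lemma low_path_probability:
  assumes "2/3 \<le> p" "p \<le> 1"
  shows "1/4 \<le> bern p (cone_edges (4 * m)) (\<lambda>S. of_bool (low_path m S))"
proof -
  let ?E = "cone_edges (4 * m)"
  have inj: "inj_on ((`) prod.swap) ?E" by (rule inj_on_inverseI[of _ "(`) prod.swap"]) (simp add: image_image)
  have "bern p ?E (\<lambda>S. of_bool (low_path m S)) = bern p ((`) prod.swap ` ?E) (\<lambda>S. of_bool (low_path m S))"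
    by (simp add: cone_edges_swap)
  also have "\<dots> = bern p ?E (\<lambda>S. of_bool (high_path m S))"
    by (subst bern_image[OF _ inj]) (simp_all add: low_swap)
  finally have eq: "bern p ?E (\<lambda>S. of_bool (low_path m S)) = bern p ?E (\<lambda>S. of_bool (high_path m S))" .
  have "1/2 \<le> bern p ?E (\<lambda>S. of_bool (\<exists>x. occ S (4 * m) x))"
    by (rule survival_probability[OF assms])
  also have "\<dots> \<le> bern p ?E (\<lambda>S. of_bool (low_path m S) + of_bool (high_path m S))"
  proof (rule bern_mono)
    fix S
    have "low_path m S \<or> high_path m S" if "occ S (4 * m) x" for x
      using occ_imp_ne_path[OF that] unfolding low_path_def high_path_def by (meson nat_le_linear)
    then show "of_bool (\<exists>x. occ S (4 * m) x) \<le> (of_bool (low_path m S) + of_bool (high_path m S) :: real)"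
      by auto
  qed (use assms in auto)
  finally show ?thesis unfolding bern_add eq by simp
qed

section \<open>The second path, reflected in the line \<open>x = m\<close>\<close>

definition mirror :: "nat \<Rightarrow> vertex \<Rightarrow> vertex" where
  "mirror m v = (2 * int m - fst v, snd v)"

lemma mirror_mirror: "mirror m (mirror m v) = v"
  by (simp add: mirror_def)

lemma mirror_mirror_image: "(`) (mirror m) ` (`) (mirror m) ` S = S"
  by (simp add: image_image mirror_mirror)

lemma two_low_paths_probability:
  fixes m :: nat
  assumes "2/3 \<le> p" "p \<le> 1"
  defines "E \<equiv> cone_edges (4 * m) \<union> (`) (mirror m) ` cone_edges (4 * m)"
  shows "1/16 \<le> bern p E (\<lambda>S. of_bool (low_path m S \<and> low_path m ((`) (mirror m) ` S)))"
proof -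
  let ?C = "cone_edges (4 * m)"
  let ?f = "\<lambda>S. of_bool (low_path m S) :: real"
  let ?g = "\<lambda>S. of_bool (low_path m ((`) (mirror m) ` S)) :: real"
  have inj: "inj_on ((`) (mirror m)) A" for A
    by (rule inj_on_inverseI[of _ "(`) (mirror m)"]) (simp add: image_image mirror_mirror)
  have fin: "finite E" by (simp add: E_def)
  have "bern p E ?f = bern p ?C ?f"
    by (rule bern_restrict[OF fin]) (auto simp: E_def low_path_restrict[symmetric])
  moreover have "bern p E ?g = bern p ((`) (mirror m) ` ?C) ?g"
  proof (rule bern_restrict[OF fin])
    fix S
    have "(`) (mirror m) ` (S \<inter> (`) (mirror m) ` ?C) = (`) (mirror m) ` S \<inter> ?C"
      by (simp add: image_Int[OF inj_on_subset[OF inj[of UNIV]]] mirror_mirror_image)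
    then show "?g S = ?g (S \<inter> (`) (mirror m) ` ?C)"
      using low_path_restrict[of m "(`) (mirror m) ` S"] by simp
  qed (auto simp: E_def)
  moreover have "\<dots> = bern p ?C ?f"
    by (subst bern_image[OF _ inj]) (simp_all add: mirror_mirror_image)
  ultimately have "1/4 * (1/4) \<le> bern p E ?f * bern p E ?g"
    using low_path_probability[OF assms(1,2), of m] by (simp only:) (intro mult_mono, auto)
  also have "\<dots> \<le> bern p E (\<lambda>S. ?f S * ?g S)"
  proof (rule harris_inequality[OF fin])
    show "mono_on (Pow E) ?f" by (auto simp: mono_on_def intro: low_path_mono)
    show "mono_on (Pow E) ?g" by (auto simp: mono_on_def intro: low_path_mono[OF _ image_mono])
  qed (use assms in auto)
  finally show ?thesis by (simp add: of_bool_conj)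
qed

text \<open>By \<open>a \<le> b\<close>, \<open>X\<close> meets the line \<open>x = m\<close> weakly
  below the mirror image of \<open>Y\<close>. It cannot remain below, as \<open>Y\<close> up to
  \<open>b\<close> has height at most \<open>m\<close>. At the last column position where it does,
  the heights agree, and \<open>i + j\<close> is \<open>2 * m\<close> plus twice a height of at most
  \<open>m\<close>.\<close>

lemma crossing_aux:
  assumes X: "ne_path S (4 * m) X" and Y: "ne_path T (4 * m) Y"
    and a: "a \<le> 2 * m" "X a = m" and b: "b \<le> 2 * m" "Y b = m" and ab: "a \<le> b"
  shows "\<exists>i j. i \<le> 4 * m \<and> j \<le> 4 * m \<and> X i + Y j = 2 * m \<and> i - X i = j - Y j \<and> i + j \<le> 4 * m"
proof (cases "m = 0")
  case True
  then show ?thesis using X Y by (intro exI[of _ 0]) (simp add: ne_path_def)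
next
  case False
  text \<open>Follow \<open>X\<close> for as long as it stays weakly below the mirror image of \<open>Y\<close>.\<close>
  define below where "below i \<longleftrightarrow> (\<exists>j\<le>b. X i + Y j = 2 * m \<and> i - X i \<le> j - Y j)" for i
  have b_le: "j - Y j \<le> m" if "j \<le> b" for j
    using ne_path_mono_index[OF Y that] b by auto
  have "below a" unfolding below_def using a b ab by (intro exI[of _ b]) auto
  moreover have "\<not> below (4 * m)"
  proof
    assume "below (4 * m)"
    then obtain j where "j \<le> b" "X (4 * m) + Y j = 2 * m" "4 * m - X (4 * m) \<le> j - Y j"
      by (auto simp: below_def)
    then show False using b_le[of j] False by linarith
  qed
  moreover have "a \<le> 4 * m" using a by simp
  ultimately obtain i where i: "i < 4 * m" "below i" "\<not> below (Suc i)"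
  proof -
    have "\<exists>i<4*m. below i \<and> \<not> below (Suc i)"
    proof (rule ccontr)
      assume n: "\<not> ?thesis"
      have "below k" if "a \<le> k" "k \<le> 4 * m" for k
        using that
      proof (induction k rule: dec_induct)
        case base then show ?case using \<open>below a\<close> by simp
      next
        case (step k) then show ?case using n by auto
      qed
      then show False using \<open>\<not> below (4 * m)\<close> \<open>a \<le> 4 * m\<close> by blast
    qed
    then show ?thesis using that by blast
  qed
  define Q where "Q j \<longleftrightarrow> j \<le> b \<and> X i + Y j = 2 * m \<and> i - X i \<le> j - Y j" for j
  \<comment> \<open>The lowest vertex of \<open>Y\<close> in the column that is weakly above
    \<open>X\<close>. If it were strictly above, a vertical step into it would contradict
    minimality, and a horizontal one would let \<open>X\<close> stay below for one more
    step.\<close>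
  define j where "j = (LEAST j. Q j)"
  have "\<exists>j. Q j" using i(2) by (auto simp: below_def Q_def)
  then have Qj: "Q j" unfolding j_def by (rule LeastI_ex)
  have least: "\<not> Q k" if "k < j" for k using that not_less_Least unfolding j_def by blast
  have Xi: "X i \<le> i" using ne_path_le[OF X] i by simp
  have "i - X i = j - Y j"
  proof (rule ccontr)
    assume "i - X i \<noteq> j - Y j"
    with Qj have lt: "i - X i < j - Y j" by (simp add: Q_def)
    then obtain k where k: "j = Suc k" by (cases j) auto
    have kb: "k < 4 * m" "k \<le> b" using Qj k b by (auto simp: Q_def)
    have Yk: "Y k \<le> k" using ne_path_le[OF Y] kb by simp
    from ne_path_step[OF Y kb(1)] show False
    proof
      assume e: "Y (Suc k) = Y k"
      have "Q k" using Qj lt e k kb Yk by (auto simp: Q_def)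
      then show False using least[of k] k by simp
    next
      assume e: "Y (Suc k) = Suc (Y k)"
      from ne_path_step[OF X i(1)] have "below (Suc i)"
      proof
        assume "X (Suc i) = X i"
        then show ?thesis unfolding below_def using Qj lt Xi by (intro exI[of _ j]) (auto simp: Q_def)
      next
        assume "X (Suc i) = Suc (X i)"
        then show ?thesis unfolding below_def using Qj lt e k kb by (intro exI[of _ k]) (auto simp: Q_def)
      qed
      then show False using i by simp
    qed
  qed
  moreover have "i + j \<le> 4 * m"
    using calculation Qj b_le[of j] Xi ne_path_le[OF Y, of j] b by (auto simp: Q_def)
  ultimately show ?thesis using Qj b i by (intro exI[of _ i] exI[of _ j]) (auto simp: Q_def)
qed

lemma ne_path_hits:
  assumes X: "ne_path S n X" and k: "k \<le> n" "m \<le> X k"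
  shows "\<exists>a\<le>k. X a = m"
  using k
proof (induction k)
  case 0
  then show ?case using X by (auto simp: ne_path_def)
next
  case (Suc k)
  show ?case
  proof (cases "m \<le> X k")
    case True
    then show ?thesis using Suc by (meson Suc_leD le_SucI)
  next
    case False
    then have "X (Suc k) = m" using Suc.prems ne_path_step[OF X, of k] by auto
    then show ?thesis by blast
  qed
qed

lemma crossing:
  assumes X: "ne_path S (4 * m) X" "m \<le> X (2 * m)" and Y: "ne_path T (4 * m) Y" "m \<le> Y (2 * m)"
  shows "\<exists>i j. i \<le> 4 * m \<and> j \<le> 4 * m \<and> X i + Y j = 2 * m \<and> i - X i = j - Y j \<and> i + j \<le> 4 * m"
proof -
  obtain a where a: "a \<le> 2 * m" "X a = m" using ne_path_hits[OF X(1) _ X(2)] by auto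
  obtain b where b: "b \<le> 2 * m" "Y b = m" using ne_path_hits[OF Y(1) _ Y(2)] by auto
  show ?thesis
  proof (cases "a \<le> b")
    case True
    then show ?thesis using crossing_aux[OF X(1) Y(1) a b] by blast
  next
    case False
    then obtain i j where "i \<le> 4 * m" "j \<le> 4 * m" "Y i + X j = 2 * m" "i - Y i = j - X j" "i + j \<le> 4 * m"
      using crossing_aux[OF Y(1) X(1) b a] by auto
    then show ?thesis by (intro exI[of _ j] exI[of _ i]) (auto simp: add.commute)
  qed
qed

section \<open>From crossing paths to a self-avoiding open path\<close>

definition open_rel :: "vertex set set \<Rightarrow> (vertex \<times> vertex) set" where
  "open_rel S = {(u, v). adj u v \<and> {u, v} \<in> S}"

lemma sym_open_rel: "sym (open_rel S)"
  by (auto simp: open_rel_def sym_def adj_def insert_commute abs_minus_commute)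

lemma relpow_sym: "sym R \<Longrightarrow> (x, y) \<in> R ^^ n \<Longrightarrow> (y, x) \<in> R ^^ n"
proof (induction n arbitrary: y)
  case (Suc n)
  then obtain z where z: "(x, z) \<in> R ^^ n" "(z, y) \<in> R" by auto
  then have "(z, x) \<in> R ^^ n" "(y, z) \<in> R" using Suc by (auto dest: symD)
  then show ?case by (rule relpow_Suc_I2[rotated])
qed simp

lemma ne_path_relpow:
  assumes "ne_path S n X" "i \<le> n" "\<And>e. e \<in> S \<Longrightarrow> h ` e \<in> T" "\<And>u v. adj u v \<Longrightarrow> adj (h u) (h v)"
  shows "(h (0, 0), h (site i (X i))) \<in> open_rel T ^^ i"
  using assms(2)
proof (induction i)
  case 0
  then show ?case using assms(1) by (simp add: ne_path_def site_def)
next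
  case (Suc i)
  have e: "{site i (X i), site (Suc i) (X (Suc i))} \<in> S" "adj (site i (X i)) (site (Suc i) (X (Suc i)))"
  proof -
    have "X (Suc i) = X i \<and> up_edge i (X i) \<in> S \<or> X (Suc i) = Suc (X i) \<and> right_edge i (X i) \<in> S"
      using assms(1) Suc.prems by (simp add: ne_path_def)
    then show "{site i (X i), site (Suc i) (X (Suc i))} \<in> S" "adj (site i (X i)) (site (Suc i) (X (Suc i)))"
      by (auto simp: up_edge_def right_edge_def adj_def site_def)
  qed
  then have "(h (site i (X i)), h (site (Suc i) (X (Suc i)))) \<in> open_rel T"
    using assms(3)[OF e(1)] assms(4)[OF e(2)] by (simp add: open_rel_def)
  then show ?case using Suc by auto
qed

lemma low_paths_relpow:
  assumes "low_path m S" "low_path m ((`) (mirror m) ` S)"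
  shows "\<exists>n\<le>4 * m. ((0, 0), (2 * int m, 0)) \<in> open_rel S ^^ n"
proof -
  obtain X where X: "ne_path S (4 * m) X" "m \<le> X (2 * m)" using assms by (auto simp: low_path_def)
  obtain Y where Y: "ne_path ((`) (mirror m) ` S) (4 * m) Y" "m \<le> Y (2 * m)" using assms by (auto simp: low_path_def)
  from crossing[OF X Y] obtain i j where ij: "i \<le> 4 * m" "j \<le> 4 * m" "X i + Y j = 2 * m"
    "i - X i = j - Y j" "i + j \<le> 4 * m" by blast
  have 1: "((0, 0), site i (X i)) \<in> open_rel S ^^ i"
    using ne_path_relpow[OF X(1) ij(1), of id S] by simp
  have "(mirror m (0, 0), mirror m (site j (Y j))) \<in> open_rel S ^^ j"
    by (rule ne_path_relpow[OF Y(1) ij(2)])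
       (auto simp: image_image mirror_mirror adj_def mirror_def)
  then have "(mirror m (site j (Y j)), mirror m (0, 0)) \<in> open_rel S ^^ j"
    by (rule relpow_sym[OF sym_open_rel])
  moreover have "mirror m (site j (Y j)) = site i (X i)"
    using ij ne_path_le[OF X(1) ij(1)] ne_path_le[OF Y(1) ij(2)] by (auto simp: mirror_def site_def)
  moreover have "mirror m (0, 0) = (2 * int m, 0)" by (simp add: mirror_def)
  ultimately have "((0, 0), (2 * int m, 0)) \<in> open_rel S ^^ (i + j)"
    using 1 by (auto simp: relpow_add)
  then show ?thesis using ij by blast
qed

text \<open>A walk of minimal length is self-avoiding: the loop at a repeated vertex could be cut
  out.\<close>

lemma relpow_imp_sa_path:
  assumes "(x, y) \<in> open_rel S ^^ n"
  shows "\<exists>p. sa_path p x y \<and> length p \<le> Suc n \<and> (\<forall>i. Suc i < length p \<longrightarrow> {p ! i, p ! Suc i} \<in> S)"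
proof -
  define k where "k = (LEAST k. (x, y) \<in> open_rel S ^^ k)"
  have k: "(x, y) \<in> open_rel S ^^ k" unfolding k_def by (rule LeastI[where P="\<lambda>k. (x, y) \<in> open_rel S ^^ k", OF assms])
  have kn: "k \<le> n" unfolding k_def by (rule Least_le[where P="\<lambda>k. (x, y) \<in> open_rel S ^^ k", OF assms])
  have least: "(x, y) \<notin> open_rel S ^^ l" if "l < k" for l using that not_less_Least unfolding k_def by blast
  from k obtain f where f: "f 0 = x" "f k = y" "\<And>i. i < k \<Longrightarrow> (f i, f (Suc i)) \<in> open_rel S"
    by (auto simp: relpow_fun_conv)
  have pw: "(f a, f b) \<in> open_rel S ^^ (b - a)" if "a \<le> b" "b \<le> k" for a b
    unfolding relpow_fun_conv using that f by (intro exI[of _ "\<lambda>i. f (a + i)"]) auto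
  have inj: "inj_on f {0..<Suc k}"
  proof (rule linorder_inj_onI)
    fix a b assume ab: "a < b" "a \<in> {0..<Suc k}" "b \<in> {0..<Suc k}"
    show "f a \<noteq> f b"
    proof
      assume "f a = f b"
      have "(x, f a) \<in> open_rel S ^^ (a - 0)" using pw[of 0 a] ab f(1) by auto
      moreover have "(f a, y) \<in> open_rel S ^^ (k - b)" using pw[of b k] ab f(2) \<open>f a = f b\<close> by auto
      ultimately have "(x, y) \<in> open_rel S ^^ ((a - 0) + (k - b))"
        unfolding relpow_add by (rule relcompI)
      moreover have "(a - 0) + (k - b) < k" using ab by auto
      ultimately show False using least by blast
    qed
  qed auto
  define p where "p = map f [0..<Suc k]"
  have nth: "i \<le> k \<Longrightarrow> p ! i = f i" for i by (simp add: p_def del: upt_Suc)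
  have len: "length p = Suc k" by (simp add: p_def)
  have step: "(p ! i, p ! Suc i) \<in> open_rel S" if "Suc i < length p" for i
    using that f(3)[of i] nth[of i] nth[of "Suc i"] len by simp
  have "sa_path p x y"
    unfolding sa_path_def
  proof (intro conjI allI impI)
    show "p \<noteq> []" using len by auto
    then show "hd p = x" "last p = y" using f nth[of 0] nth[of k] len by (simp_all add: hd_conv_nth last_conv_nth)
    show "distinct p" using inj by (simp add: p_def distinct_map del: upt_Suc)
    show "adj (p ! i) (p ! Suc i)" if "Suc i < length p" for i using step[OF that] by (simp add: open_rel_def)
  qed
  moreover have "\<forall>i. Suc i < length p \<longrightarrow> {p ! i, p ! Suc i} \<in> S" using step by (auto simp: open_rel_def)
  ultimately show ?thesis using len kn by (intro exI[of _ p]) auto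
qed

section \<open>Upper tail of the passage time\<close>

lemma adj_in_lattice_edges: "adj x y \<Longrightarrow> {x, y} \<in> lattice_edges"
  unfolding lattice_edges_def by blast

lemma countable_lattice_edges: "countable lattice_edges"
proof -
  have "lattice_edges \<subseteq> (\<lambda>(x, y). {x, y}) ` UNIV" by (auto simp: lattice_edges_def)
  then show ?thesis by (rule countable_subset) simp
qed

lemma cone_edges_lattice: "cone_edges n \<subseteq> lattice_edges"
  by (auto simp: cone_edges_def level_edges_def up_edge_def right_edge_def site_def adj_def
      intro!: adj_in_lattice_edges)

lemma mirror_lattice_edges: "e \<in> lattice_edges \<Longrightarrow> mirror m ` e \<in> lattice_edges"
  by (auto simp: lattice_edges_def mirror_def adj_def)
     (metis (no_types, opaque_lifting) abs_minus_commute add_diff_cancel_left' diff_diff_eq2 fst_conv snd_conv)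

lemma passage_time_measurable:
  assumes "\<And>e. e \<in> lattice_edges \<Longrightarrow> \<omega> e \<in> borel_measurable M"
  shows "(\<lambda>s. passage_time (\<lambda>e. \<omega> e s) x y) \<in> borel_measurable M"
  unfolding passage_time_def
proof (rule borel_measurable_cINF_real)
  fix p assume "p \<in> {p. sa_path p x y}"
  then show "(\<lambda>s. path_weight (\<lambda>e. \<omega> e s) p) \<in> borel_measurable M"
    unfolding path_weight_def sa_path_def
    by (intro borel_measurable_sum assms adj_in_lattice_edges) auto
qed simp

lemma path_weight_nonneg:
  assumes "\<And>e. e \<in> lattice_edges \<Longrightarrow> 0 \<le> w e" "sa_path p x y"
  shows "0 \<le> path_weight w p"
  unfolding path_weight_def
proof (rule sum_nonneg)
  fix i assume "i \<in> {..<length p - 1}"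
  then have "adj (p ! i) (p ! Suc i)" using assms(2) by (auto simp: sa_path_def)
  then show "0 \<le> w {p ! i, p ! Suc i}" by (intro assms(1) adj_in_lattice_edges)
qed

lemma passage_time_le:
  assumes "\<And>e. e \<in> lattice_edges \<Longrightarrow> 0 \<le> w e" "sa_path p x y"
  shows "passage_time w x y \<le> path_weight w p"
proof -
  have "bdd_below (path_weight w ` {p. sa_path p x y})"
  proof (rule bdd_belowI2)
    fix q assume "q \<in> {p. sa_path p x y}"
    then have "sa_path q x y" by simp
    show "0 \<le> path_weight w q" by (rule path_weight_nonneg[OF _ \<open>sa_path q x y\<close>]) (rule assms(1))
  qed
  then show ?thesis unfolding passage_time_def by (rule cINF_lower) (use assms in simp)
qed

lemma (in prob_space) prob_open_edges:
  fixes \<omega> :: "'e \<Rightarrow> 'a \<Rightarrow> real"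
  assumes ind: "indep_vars (\<lambda>_. borel) \<omega> I" and E: "finite E" "E \<subseteq> I"
    and p: "\<And>e. e \<in> E \<Longrightarrow> prob {s \<in> space M. \<omega> e s \<le> t} = p"
  shows "{s \<in> space M. Q {e \<in> E. \<omega> e s \<le> t}} \<in> events"
    and "prob {s \<in> space M. Q {e \<in> E. \<omega> e s \<le> t}} = bern p E (\<lambda>S. of_bool (Q S))"
proof -
  have rv: "random_variable borel (\<omega> e)" if "e \<in> E" for e
    using ind E that by (auto simp: indep_vars_def)
  define C where "C S = {s \<in> space M. {e \<in> E. \<omega> e s \<le> t} = S}" for S
  define A where "A S e = (if e \<in> S then {..t} else {t<..})" for S :: "'e set" and e
  \<comment> \<open>An intersection over no edges would be \<open>UNIV\<close> instead of
    \<open>space M\<close>.\<close>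
  have Cint: "C S = (if E = {} then space M else (\<Inter>e\<in>E. \<omega> e -` A S e \<inter> space M))" if "S \<subseteq> E" for S
    using that by (auto simp: C_def A_def split: if_splits)
  have Cev: "C S \<in> events" if S: "S \<subseteq> E" for S
  proof (cases "E = {}")
    case False
    have "\<omega> e -` A S e \<inter> space M \<in> events" if "e \<in> E" for e
      by (rule measurable_sets[OF rv[OF that]]) (auto simp: A_def)
    then have "(\<Inter>e\<in>E. \<omega> e -` A S e \<inter> space M) \<in> events" using E False by (intro sets.finite_INT)
    then show ?thesis unfolding Cint[OF S] using False by simp
  qed (simp add: Cint[OF S])
  have one: "prob (\<omega> e -` A S e \<inter> space M) = (if e \<in> S then p else 1 - p)" if e: "e \<in> E" for e S
  proof -
    have s: "\<omega> e -` {..t} \<inter> space M = {s \<in> space M. \<omega> e s \<le> t}"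
      "\<omega> e -` {t<..} \<inter> space M = space M - {s \<in> space M. \<omega> e s \<le> t}" by auto
    have ev: "{s \<in> space M. \<omega> e s \<le> t} \<in> events"
      using measurable_sets[OF rv[OF e], of "{..t}"] s by simp
    show ?thesis using p[OF e] prob_compl[OF ev] s by (auto simp: A_def)
  qed
  have Cprob: "prob (C S) = p ^ card S * (1 - p) ^ card (E - S)" if S: "S \<subseteq> E" for S
  proof (cases "E = {}")
    case True
    then show ?thesis using S by (simp add: Cint prob_space)
  next
    case False
    have "prob (C S) = (\<Prod>e\<in>E. prob (\<omega> e -` A S e \<inter> space M))"
    proof -
      have "prob (\<Inter>e\<in>E. \<omega> e -` A S e \<inter> space M) = (\<Prod>e\<in>E. prob (\<omega> e -` A S e \<inter> space M))"
        using False E by (intro indep_varsD[OF ind]) (auto simp: A_def)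
      then show ?thesis unfolding Cint[OF S] using False by (simp only: if_False)
    qed
    also have "\<dots> = (\<Prod>e\<in>E. if e \<in> S then p else 1 - p)" by (rule prod.cong) (auto simp: one)
    also have "\<dots> = p ^ card (E \<inter> S) * (1 - p) ^ card (E \<inter> - S)"
      using E by (simp add: prod.If_cases)
    also have "E \<inter> S = S" using S by auto
    also have "E \<inter> - S = E - S" by auto
    finally show ?thesis .
  qed
  let ?U = "{s \<in> space M. Q {e \<in> E. \<omega> e s \<le> t}}"
  let ?I = "{S \<in> Pow E. Q S}"
  have U: "?U = (\<Union>S\<in>?I. C S)" by (auto simp: C_def)
  have fin: "finite ?I" using E by simp
  show "?U \<in> events" unfolding U using Cev fin by (intro sets.finite_UN) auto
  have "prob ?U = (\<Sum>S\<in>?I. prob (C S))" unfolding U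
  proof (rule finite_measure_finite_Union[OF fin])
    show "C ` ?I \<subseteq> events" using Cev by auto
    show "disjoint_family_on C ?I" by (auto simp: disjoint_family_on_def C_def)
  qed
  also have "\<dots> = (\<Sum>S\<in>?I. p ^ card S * (1 - p) ^ card (E - S))"
    by (rule sum.cong) (auto simp: Cprob)
  also have "\<dots> = bern p E (\<lambda>S. of_bool (Q S))"
    unfolding bern_def using E by (intro sum.mono_neutral_cong_left) auto
  finally show "prob ?U = bern p E (\<lambda>S. of_bool (Q S))" .
qed

locale fpp = prob_space M for M :: "'a measure" +
  fixes F :: "real measure" and \<omega> :: "vertex set \<Rightarrow> 'a \<Rightarrow> real"
  assumes prob_F: "prob_space F" and sets_F: "sets F = sets borel" and F_nonneg: "measure F {..<0} = 0"
    and indep: "indep_vars (\<lambda>_. borel) \<omega> lattice_edges"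
    and distr_\<omega>: "\<And>e. e \<in> lattice_edges \<Longrightarrow> distr M borel (\<omega> e) = F"
begin

lemma rv_\<omega>: "e \<in> lattice_edges \<Longrightarrow> \<omega> e \<in> borel_measurable M"
  using indep by (auto simp: indep_vars_def)

lemma prob_\<omega>:
  assumes "e \<in> lattice_edges" "A \<in> sets borel"
  shows "prob {s \<in> space M. \<omega> e s \<in> A} = measure F A"
proof -
  have "measure F A = measure (distr M borel (\<omega> e)) A" using distr_\<omega>[OF assms(1)] by simp
  also have "\<dots> = prob (\<omega> e -` A \<inter> space M)" by (rule measure_distr[OF rv_\<omega>[OF assms(1)] assms(2)])
  also have "\<omega> e -` A \<inter> space M = {s \<in> space M. \<omega> e s \<in> A}" by auto
  finally show ?thesis by simp
qed

text \<open>Off this null set the infimum in \<open>passage_time\<close> is taken over a set bounded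
  below, so that \<open>Inf\<close> has its usual meaning.\<close>

lemma AE_nonneg: "AE s in M. \<forall>e\<in>lattice_edges. 0 \<le> \<omega> e s"
proof -
  have "AE s in M. 0 \<le> \<omega> e s" if e: "e \<in> lattice_edges" for e
  proof (rule AE_I)
    have "prob {s \<in> space M. \<omega> e s \<in> {..<0}} = 0" using prob_\<omega>[OF e, of "{..<0}"] F_nonneg by simp
    then show "emeasure M {s \<in> space M. \<omega> e s \<in> {..<0}} = 0" by (simp add: emeasure_eq_measure)
    show "{s \<in> space M. \<omega> e s \<in> {..<0}} \<in> sets M"
      using measurable_sets[OF rv_\<omega>[OF e], of "{..<0}"] by (simp add: vimage_def Int_def conj_commute)
  qed auto
  then show ?thesis using countable_lattice_edges by (simp add: AE_ball_countable)
qed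

definition T :: "nat \<Rightarrow> 'a \<Rightarrow> real" where
  "T n s = passage_time (\<lambda>e. \<omega> e s) (0, 0) (int n, 0)"

lemma T_measurable [measurable]: "T n \<in> borel_measurable M"
  unfolding T_def by (rule passage_time_measurable) (rule rv_\<omega>)

lemma passage_time_upper:
  assumes "0 \<le> t" "2/3 \<le> measure F {..t}"
  shows "1/16 \<le> prob {s \<in> space M. T (2 * m) s \<le> real (4 * m) * t}"
proof -
  define p where "p = measure F {..t}"
  interpret F: prob_space F by (rule prob_F)
  have p: "2/3 \<le> p" "p \<le> 1" using assms by (auto simp: p_def)
  define E where "E = cone_edges (4 * m) \<union> (`) (mirror m) ` cone_edges (4 * m)"
  have E: "finite E" "E \<subseteq> lattice_edges"
    using cone_edges_lattice mirror_lattice_edges by (auto simp: E_def)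
  let ?Q = "\<lambda>S. low_path m S \<and> low_path m ((`) (mirror m) ` S)"
  let ?U = "{s \<in> space M. ?Q {e \<in> E. \<omega> e s \<le> t}}"
  have pe: "prob {s \<in> space M. \<omega> e s \<le> t} = p" if "e \<in> E" for e
    using prob_\<omega>[of e "{..t}"] that E by (auto simp: p_def)
  have "1/16 \<le> prob ?U"
    using two_low_paths_probability[OF p, of m] prob_open_edges(2)[OF indep E pe, of ?Q] by (simp add: E_def)
  also have "\<dots> \<le> prob {s \<in> space M. T (2 * m) s \<le> real (4 * m) * t}"
  proof (rule finite_measure_mono_AE)
    show "AE s in M. s \<in> ?U \<longrightarrow> s \<in> {s \<in> space M. T (2 * m) s \<le> real (4 * m) * t}"
      using AE_nonneg
    proof eventually_elim
      case (elim s)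
      show ?case
      proof
        assume s: "s \<in> ?U"
        define S where "S = {e \<in> E. \<omega> e s \<le> t}"
        have "?Q S" using s by (simp add: S_def)
        then obtain n where n: "n \<le> 4 * m" "((0, 0), (2 * int m, 0)) \<in> open_rel S ^^ n"
          using low_paths_relpow by blast
        from relpow_imp_sa_path[OF n(2)] obtain q where q: "sa_path q (0, 0) (2 * int m, 0)"
          "length q \<le> Suc n" "\<forall>i. Suc i < length q \<longrightarrow> {q ! i, q ! Suc i} \<in> S" by blast
        have "T (2 * m) s \<le> path_weight (\<lambda>e. \<omega> e s) q"
          unfolding T_def using elim q(1) by (intro passage_time_le) auto
        also have "\<dots> \<le> (\<Sum>i<length q - 1. t)"
          unfolding path_weight_def using q(3) by (intro sum_mono) (auto simp: S_def)
        also have "\<dots> = real (length q - 1) * t" by simp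
        also have "\<dots> \<le> real (4 * m) * t" using q(2) n(1) assms(1) by (intro mult_right_mono) auto
        finally show "s \<in> {s \<in> space M. T (2 * m) s \<le> real (4 * m) * t}" using s by simp
      qed
    qed
  qed measurable
  finally show ?thesis .
qed

end

section \<open>Counting self-avoiding paths\<close>

definition dirs :: "vertex set" where
  "dirs = {(1, 0), (-1, 0), (0, 1), (0, -1)}"

text \<open>Walks are built backwards from their end. A new first vertex further left increases the
  distance to the target on the right that the walk covers, so steps by -1 are favoured.\<close>

definition tilt :: "vertex \<Rightarrow> real" where
  "tilt d = (if fst d = -1 then 11/10 else if fst d = 1 then 10/11 else 1)"

text \<open>The constants are an approximate Perron eigenvector, found numerically, of the transfer matrix on
  the last three steps of a walk that avoids backtracking and unit squares.\<close>

definition pot :: "vertex \<Rightarrow> vertex \<Rightarrow> vertex \<Rightarrow> real" where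
  "pot d1 d2 d3 = (if fst d1 = -1 then 104/100 else if fst d1 = 1 then 96/100 else 1) *
     (if d1 = d2 then 1 else if d1 = - d3 then 3/4 else 95/100)"

lemma pot_bounds: "18/25 \<le> pot a b c" "pot a b c \<le> 104/100"
  by (auto simp: pot_def)

text \<open>A finite check over the admissible triples. The excluded steps are backtracking and, for
  \<open>d1 = - d3\<close> and \<open>d = - d2\<close>, the closing of a unit square.\<close>

lemma pot_step:
  assumes "d1 \<in> dirs" "d2 \<in> dirs" "d3 \<in> dirs" "d1 \<noteq> - d2" "d2 \<noteq> - d3"
  shows "(\<Sum>d\<in>dirs. if d = - d1 \<or> d1 = - d3 \<and> d = - d2 then 0 else tilt d * pot d d1 d2)
    \<le> 59/20 * pot d1 d2 d3"
  using assms unfolding dirs_def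
  by (simp only: insert_iff empty_iff HOL.simp_thms, elim disjE; simp add: tilt_def pot_def)

lemma adj_iff_dirs: "adj x y \<longleftrightarrow> x - y \<in> dirs"
  by (cases x; cases y) (auto simp: adj_def dirs_def)

text \<open>Walks with fewer than three steps have no complete state. Their values are such that
  even all four extensions, of total tilt \<open>441/110\<close>, respect the rate
  \<open>59/20\<close>.\<close>

fun path_pot :: "vertex list \<Rightarrow> real" where
  "path_pot (v0 # v1 # v2 # v3 # vs) = pot (v0 - v1) (v1 - v2) (v2 - v3)"
| "path_pot [v0, v1, v2] = 3/2"
| "path_pot [v0, v1] = 21/10"
| "path_pot vs = 3"

lemma path_pot_ge: "18/25 \<le> path_pot p"
proof (cases p rule: path_pot.cases)
  case (1 v0 v1 v2 v3 vs)
  then show ?thesis using pot_bounds(1)[of "v0 - v1" "v1 - v2" "v2 - v3"] by (simp only: path_pot.simps)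
qed auto

section \<open>Self-avoiding walks extended at their first vertex\<close>

definition walks :: "vertex \<Rightarrow> nat \<Rightarrow> vertex list set" where
  "walks y N = {p. length p = Suc N \<and> last p = y \<and> distinct p \<and>
     (\<forall>i. Suc i < length p \<longrightarrow> adj (p ! i) (p ! Suc i))}"

definition extensions :: "vertex list \<Rightarrow> vertex set" where
  "extensions p = {d \<in> dirs. hd p + d \<notin> set p}"

lemma extensions_subset: "extensions p \<subseteq> dirs" "finite (extensions p)" "finite dirs"
  by (auto simp: extensions_def dirs_def)

lemma walks_0: "walks y 0 = {[y]}"
  by (auto simp: walks_def length_Suc_conv)

lemma walks_Suc: "walks y (Suc N) = (\<lambda>(p, d). (hd p + d) # p) ` (SIGMA p:walks y N. extensions p)"
proof (intro equalityI subsetI)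
  fix q assume q: "q \<in> walks y (Suc N)"
  then obtain v p where vp: "q = v # p" "p \<noteq> []" by (auto simp: walks_def length_Suc_conv)
  have step: "adj (q ! i) (q ! Suc i)" if "Suc i < length q" for i using q that by (auto simp: walks_def)
  have "adj v (hd p)" using step[of 0] vp by (simp add: hd_conv_nth)
  then have d: "v - hd p \<in> dirs" by (simp add: adj_iff_dirs)
  have "p \<in> walks y N"
    using q vp step[of "Suc _"] by (auto simp: walks_def)
  moreover have "v - hd p \<in> extensions p" using q vp d by (auto simp: walks_def extensions_def)
  moreover have "q = (\<lambda>(p, d). (hd p + d) # p) (p, v - hd p)" using vp by simp
  ultimately show "q \<in> (\<lambda>(p, d). (hd p + d) # p) ` (SIGMA p:walks y N. extensions p)" by blast
next
  fix q assume "q \<in> (\<lambda>(p, d). (hd p + d) # p) ` (SIGMA p:walks y N. extensions p)"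
  then obtain p d where p: "p \<in> walks y N" "d \<in> extensions p" "q = (hd p + d) # p" by auto
  have ne: "p \<noteq> []" using p by (auto simp: walks_def)
  have "adj (q ! i) (q ! Suc i)" if "Suc i < length q" for i
  proof (cases i)
    case 0
    then show ?thesis using p ne by (simp add: adj_iff_dirs extensions_def hd_conv_nth)
  next
    case (Suc j)
    then show ?thesis using p that by (auto simp: walks_def)
  qed
  then show "q \<in> walks y (Suc N)" using p ne by (auto simp: walks_def extensions_def)
qed

lemma finite_walks: "finite (walks y N)"
  by (induction N) (auto simp: walks_0 walks_Suc extensions_subset intro!: finite_SigmaI)

definition path_tilt :: "vertex \<Rightarrow> vertex list \<Rightarrow> real" where
  "path_tilt y p = (11/10) powi (fst y - fst (hd p))"

lemma path_tilt_pos: "0 < path_tilt y p"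
  by (simp add: path_tilt_def)

lemma path_tilt_Cons:
  assumes "d \<in> dirs"
  shows "path_tilt y ((hd p + d) # p) = path_tilt y p * tilt d"
proof -
  have "path_tilt y ((hd p + d) # p) = (11/10) powi ((fst y - fst (hd p)) + (- fst d))"
    by (simp add: path_tilt_def algebra_simps)
  also have "\<dots> = path_tilt y p * (11/10) powi (- fst d)"
    unfolding path_tilt_def by (rule power_int_add) simp
  also have "(11/10) powi (- fst d) = tilt d" using assms by (auto simp: dirs_def tilt_def)
  finally show ?thesis .
qed

lemma path_pot_step:
  assumes "p \<in> walks y N"
  shows "(\<Sum>d\<in>extensions p. tilt d * path_pot ((hd p + d) # p)) \<le> 59/20 * path_pot p"
proof -
  have tilt_sum: "(\<Sum>d\<in>dirs. tilt d * c) = 441/110 * c" for c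
    by (simp add: dirs_def tilt_def)
  have tilt0: "0 \<le> tilt d" for d by (simp add: tilt_def)
  have crude: "(\<Sum>d\<in>extensions p. tilt d * path_pot ((hd p + d) # p)) \<le> 441/110 * c"
    if "\<And>d. path_pot ((hd p + d) # p) \<le> c" "0 \<le> c" for c
  proof -
    have "(\<Sum>d\<in>extensions p. tilt d * path_pot ((hd p + d) # p)) \<le> (\<Sum>d\<in>extensions p. tilt d * c)"
      using that tilt0 by (intro sum_mono mult_left_mono) auto
    also have "\<dots> \<le> (\<Sum>d\<in>dirs. tilt d * c)"
      using that tilt0 by (intro sum_mono2 extensions_subset) auto
    finally show ?thesis unfolding tilt_sum .
  qed
  have adj: "adj (p ! i) (p ! Suc i)" if "Suc i < length p" for i using assms that by (simp add: walks_def)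
  show ?thesis
  proof (cases p rule: path_pot.cases)
    case (1 v0 v1 v2 v3 vs)
    define d1 d2 d3 where "d1 = v0 - v1" and "d2 = v1 - v2" and "d3 = v2 - v3"
    have dirs: "d1 \<in> dirs" "d2 \<in> dirs" "d3 \<in> dirs"
      using adj[of 0] adj[of 1] adj[of 2] 1 by (auto simp: d1_def d2_def d3_def adj_iff_dirs numeral_2_eq_2)
    have dist: "v0 \<noteq> v2" "v1 \<noteq> v3" using assms 1 by (auto simp: walks_def)
    have nb: "d1 \<noteq> - d2" "d2 \<noteq> - d3" using dist by (auto simp: d1_def d2_def d3_def)
    have "(\<Sum>d\<in>extensions p. tilt d * path_pot ((hd p + d) # p))
        = (\<Sum>d\<in>extensions p. tilt d * pot d d1 d2)" using 1 by (simp add: d1_def d2_def)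
    also have "\<dots> = (\<Sum>d\<in>extensions p. if d = - d1 \<or> d1 = - d3 \<and> d = - d2 then 0 else tilt d * pot d d1 d2)"
    proof (rule sum.cong)
      fix d assume "d \<in> extensions p"
      then have n: "v0 + d \<noteq> v1" "v0 + d \<noteq> v3" using 1 by (auto simp: extensions_def)
      have "d \<noteq> - d1" using n(1) by (auto simp: d1_def)
      moreover have "d \<noteq> - d2" if "d1 = - d3"
      proof
        assume "d = - d2"
        then have "v0 + d = v0 - v1 + v2" by (simp add: d2_def)
        also have "\<dots> = v3" using that by (simp add: d1_def d3_def algebra_simps)
        finally show False using n by simp
      qed
      ultimately show "tilt d * pot d d1 d2 = (if d = - d1 \<or> d1 = - d3 \<and> d = - d2 then 0 else tilt d * pot d d1 d2)"
        by auto
    qed simp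
    also have "\<dots> \<le> (\<Sum>d\<in>dirs. if d = - d1 \<or> d1 = - d3 \<and> d = - d2 then 0 else tilt d * pot d d1 d2)"
    proof (intro sum_mono2 extensions_subset)
      fix d
      have "0 \<le> pot d d1 d2" using pot_bounds(1)[of d d1 d2] by linarith
      then show "0 \<le> (if d = - d1 \<or> d1 = - d3 \<and> d = - d2 then 0 else tilt d * pot d d1 d2)" using tilt0 by simp
    qed
    also have "\<dots> \<le> 59/20 * pot d1 d2 d3" by (rule pot_step[OF dirs nb])
    finally show ?thesis using 1 by (simp add: d1_def d2_def d3_def)
  next
    case (2 v0 v1 v2)
    then show ?thesis using crude[of "104/100"] pot_bounds(2) by simp
  next
    case (3 v0 v1)
    then show ?thesis using crude[of "3/2"] by simp
  next
    case ("4_1")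
    then show ?thesis using assms by (simp add: walks_def)
  next
    case ("4_2" v)
    then show ?thesis using crude[of "21/10"] by simp
  qed
qed

lemma walks_weight: "(\<Sum>p\<in>walks y N. path_tilt y p * path_pot p) \<le> 3 * (59/20) ^ N"
proof (induction N)
  case 0
  then show ?case by (simp add: walks_0 path_tilt_def)
next
  case (Suc N)
  have inj: "inj_on (\<lambda>(p, d). (hd p + d) # p) (SIGMA p:walks y N. extensions p)"
    by (auto simp: inj_on_def)
  have "(\<Sum>p\<in>walks y (Suc N). path_tilt y p * path_pot p)
      = (\<Sum>(p, d)\<in>(SIGMA p:walks y N. extensions p). path_tilt y ((hd p + d) # p) * path_pot ((hd p + d) # p))"
    unfolding walks_Suc sum.reindex[OF inj] by (simp add: o_def case_prod_unfold)
  also have "\<dots> = (\<Sum>p\<in>walks y N. \<Sum>d\<in>extensions p. path_tilt y ((hd p + d) # p) * path_pot ((hd p + d) # p))"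
    by (subst sum.Sigma) (auto simp: finite_walks extensions_subset)
  also have "\<dots> = (\<Sum>p\<in>walks y N. path_tilt y p * (\<Sum>d\<in>extensions p. tilt d * path_pot ((hd p + d) # p)))"
    unfolding sum_distrib_left
    by (intro sum.cong) (auto simp: path_tilt_Cons extensions_def)
  also have "\<dots> \<le> (\<Sum>p\<in>walks y N. path_tilt y p * (59/20 * path_pot p))"
    by (intro sum_mono mult_left_mono path_pot_step less_imp_le[OF path_tilt_pos])
  also have "\<dots> = 59/20 * (\<Sum>p\<in>walks y N. path_tilt y p * path_pot p)"
    by (simp add: sum_distrib_left mult_ac)
  also have "\<dots> \<le> 3 * (59/20) ^ Suc N" using Suc by simp
  finally show ?case .
qed

section \<open>Lower tail of the passage time\<close>

definition paths_to :: "nat \<Rightarrow> nat \<Rightarrow> vertex list set" where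
  "paths_to n N = {p. sa_path p (0, 0) (int n, 0) \<and> length p = Suc N}"

lemma paths_to_walks: "paths_to n N \<subseteq> walks (int n, 0) N"
  by (auto simp: paths_to_def walks_def sa_path_def)

lemma finite_paths_to: "finite (paths_to n N)"
  by (rule finite_subset[OF paths_to_walks finite_walks])

text \<open>All these paths share the tilt \<open>(11/10) ^ n\<close> and have potential at least
  \<open>18/25\<close>; the 5 rounds up \<open>3 / (18/25)\<close>.\<close>

lemma card_paths_to: "real (card (paths_to n N)) \<le> 5 * (59/20) ^ N * (10/11) ^ n"
proof -
  have "(\<Sum>p\<in>paths_to n N. (11/10) ^ n * (18/25)) \<le> (\<Sum>p\<in>paths_to n N. path_tilt (int n, 0) p * path_pot p)"
    by (intro sum_mono mult_mono path_pot_ge less_imp_le[OF path_tilt_pos])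
       (auto simp: path_tilt_def paths_to_def sa_path_def)
  also have "\<dots> \<le> (\<Sum>p\<in>walks (int n, 0) N. path_tilt (int n, 0) p * path_pot p)"
  proof (intro sum_mono2 finite_walks paths_to_walks)
    fix p
    have "0 \<le> path_pot p" using path_pot_ge[of p] by linarith
    then show "0 \<le> path_tilt (int n, 0) p * path_pot p" using path_tilt_pos[of "(int n, 0)" p] by simp
  qed
  also have "\<dots> \<le> 3 * (59/20) ^ N" by (rule walks_weight)
  finally have "real (card (paths_to n N)) * (11/10) ^ n * (18/25) \<le> 3 * (59/20) ^ N"
    by (simp only: sum_constant mult.assoc)
  moreover have "0 \<le> (59/20 :: real) ^ N" by simp
  ultimately have "real (card (paths_to n N)) * (11/10) ^ n \<le> 5 * (59/20) ^ N" by linarith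
  then show ?thesis by (simp add: power_divide field_simps)
qed

lemma path_edges:
  assumes "sa_path p x y"
  defines "E \<equiv> (\<lambda>i. {p ! i, p ! Suc i}) ` {..<length p - 1}"
  shows "inj_on (\<lambda>i. {p ! i, p ! Suc i}) {..<length p - 1}" "finite E" "card E = length p - 1"
    "E \<subseteq> lattice_edges" "path_weight w p = sum w E"
proof -
  show inj: "inj_on (\<lambda>i. {p ! i, p ! Suc i}) {..<length p - 1}"
  proof (rule inj_onI)
    fix i j assume ij: "i \<in> {..<length p - 1}" "j \<in> {..<length p - 1}" "{p ! i, p ! Suc i} = {p ! j, p ! Suc j}"
    have d: "p ! a = p ! b \<longleftrightarrow> a = b" if "a < length p" "b < length p" for a b
      using assms(1) that by (auto simp: sa_path_def nth_eq_iff_index_eq)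
    show "i = j" using ij by (auto simp: doubleton_eq_iff d)
  qed
  show "finite E" by (simp add: E_def)
  show "card E = length p - 1" using card_image[OF inj] by (simp add: E_def)
  show "E \<subseteq> lattice_edges" using assms(1) by (auto simp: E_def sa_path_def intro!: adj_in_lattice_edges)
  show "path_weight w p = sum w E" unfolding path_weight_def E_def by (subst sum.reindex[OF inj]) simp
qed

lemma bern_closed_power:
  "finite E \<Longrightarrow> bern q E (\<lambda>S. z ^ card (E - S)) = (q + (1 - q) * z) ^ card E"
proof (induction E rule: finite_induct)
  case (insert e E)
  have "bern q E (\<lambda>S. z ^ card (insert e E - insert e S)) = bern q E (\<lambda>S. z ^ card (E - S))"
  proof (rule bern_cong)
    fix S assume "S \<subseteq> E"
    then have "insert e E - insert e S = E - S" using insert.hyps by auto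
    then show "z ^ card (insert e E - insert e S) = z ^ card (E - S)" by simp
  qed
  moreover have "bern q E (\<lambda>S. z ^ card (insert e E - S)) = bern q E (\<lambda>S. z * z ^ card (E - S))"
  proof (rule bern_cong)
    fix S assume "S \<subseteq> E"
    then have "insert e E - S = insert e (E - S)" using insert.hyps by auto
    then show "z ^ card (insert e E - S) = z * z ^ card (E - S)" using insert.hyps by simp
  qed
  ultimately show ?case using insert by (simp add: bern_insert bern_cmult algebra_simps)
qed simp

lemma ex_sa_path: "\<exists>p. sa_path p (0, 0) (int n, 0)"
proof -
  have "((0, 0), (int n, 0)) \<in> open_rel lattice_edges ^^ n"
  proof (induction n)
    case (Suc n)
    have "adj (int n, 0) (int (Suc n), 0)" by (simp add: adj_def)
    then have "((int n, 0), (int (Suc n), 0)) \<in> open_rel lattice_edges"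
      unfolding open_rel_def using adj_in_lattice_edges by blast
    with Suc show ?case by (rule relpow_Suc_I)
  qed simp
  then show ?thesis using relpow_imp_sa_path by blast
qed

context fpp
begin

text \<open>Exponential Markov inequality: a weight below \<open>k * t\<close> leaves fewer than
  \<open>k\<close> edges heavier than \<open>t\<close>, each priced at \<open>1/1000\<close>. The
  mean factor of an edge is at most \<open>1/3 + 2/3 * (1/1000) = 334/1000\<close>.\<close>

lemma cheap_path_prob:
  assumes t: "0 < t" and q: "measure F {..t} \<le> 1/3" and p: "sa_path p x y" "length p = Suc N"
  shows "{s \<in> space M. path_weight (\<lambda>e. \<omega> e s) p < real k * t} \<in> events"
    "prob {s \<in> space M. path_weight (\<lambda>e. \<omega> e s) p < real k * t} \<le> 1000 ^ k * (334/1000) ^ N"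
proof -
  define E where "E = (\<lambda>i. {p ! i, p ! Suc i}) ` {..<length p - 1}"
  note E = path_edges[OF p(1), folded E_def]
  define r where "r = measure F {..t}"
  have pe: "prob {s \<in> space M. \<omega> e s \<le> t} = r" if "e \<in> E" for e
    using prob_\<omega>[of e "{..t}"] that E(4) by (auto simp: r_def)
  have r: "0 \<le> r" "r \<le> 1/3" using q by (auto simp: r_def)
  have m: "(\<lambda>s. path_weight (\<lambda>e. \<omega> e s) p) \<in> borel_measurable M"
    unfolding E(5) using E(4) by (intro borel_measurable_sum rv_\<omega>) auto
  then show "{s \<in> space M. path_weight (\<lambda>e. \<omega> e s) p < real k * t} \<in> events" by measurable
  let ?Q = "\<lambda>S. card (E - S) < k"
  have "prob {s \<in> space M. path_weight (\<lambda>e. \<omega> e s) p < real k * t} \<le> prob {s \<in> space M. ?Q {e \<in> E. \<omega> e s \<le> t}}"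
  proof (rule finite_measure_mono_AE)
    show "AE s in M. s \<in> {s \<in> space M. path_weight (\<lambda>e. \<omega> e s) p < real k * t} \<longrightarrow>
        s \<in> {s \<in> space M. ?Q {e \<in> E. \<omega> e s \<le> t}}"
      using AE_nonneg
    proof eventually_elim
      case (elim s)
      let ?S = "{e \<in> E. \<omega> e s \<le> t}"
      have "real (card (E - ?S)) * t = (\<Sum>e\<in>E - ?S. t)" by simp
      also have "\<dots> \<le> (\<Sum>e\<in>E - ?S. \<omega> e s)" by (intro sum_mono) auto
      also have "\<dots> \<le> (\<Sum>e\<in>E. \<omega> e s)" using E elim by (intro sum_mono2) auto
      finally have "real (card (E - ?S)) * t \<le> path_weight (\<lambda>e. \<omega> e s) p" unfolding E(5) .
      then have "?Q ?S" if "path_weight (\<lambda>e. \<omega> e s) p < real k * t"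
        using that t by (smt (verit) mult_less_cancel_right of_nat_less_iff)
      then show ?case by auto
    qed
    show "{s \<in> space M. ?Q {e \<in> E. \<omega> e s \<le> t}} \<in> events"
      by (rule prob_open_edges(1)[OF indep E(2,4) pe])
  qed
  also have "\<dots> = bern r E (\<lambda>S. of_bool (?Q S))"
    by (rule prob_open_edges(2)[OF indep E(2,4) pe])
  also have "\<dots> \<le> bern r E (\<lambda>S. 1000 ^ k * (1/1000) ^ card (E - S))"
  proof (rule bern_mono)
    fix S
    show "of_bool (?Q S) \<le> 1000 ^ k * (1/1000::real) ^ card (E - S)"
    proof (cases "?Q S")
      case True
      have "(1/1000::real) ^ k \<le> (1/1000) ^ card (E - S)" using True by (intro power_decreasing) auto
      then have "1000 ^ k * (1/1000::real) ^ k \<le> 1000 ^ k * (1/1000) ^ card (E - S)" by (intro mult_left_mono) auto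
      moreover have "1000 ^ k * (1/1000::real) ^ k = 1" by (simp flip: power_mult_distrib)
      ultimately show ?thesis using True by simp
    qed simp
  qed (use r in auto)
  also have "\<dots> = 1000 ^ k * (r + (1 - r) * (1/1000)) ^ N"
    unfolding bern_cmult bern_closed_power[OF E(2)] E(3) using p(2) by simp
  also have "\<dots> \<le> 1000 ^ k * (334/1000) ^ N"
    using r by (intro mult_left_mono power_mono) (auto simp: field_simps)
  finally show "prob {s \<in> space M. path_weight (\<lambda>e. \<omega> e s) p < real k * t} \<le> 1000 ^ k * (334/1000) ^ N" .
qed

text \<open>Union bound over paths of all lengths. The distance 100 per expensive edge is chosen so
  that the drift factor \<open>(10/11) ^ 100\<close>, below \<open>1/10000\<close>, outweighs the
  price 1000; this is the 100 of the theorem.\<close>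

lemma passage_time_lower:
  assumes t: "0 < t" and q: "measure F {..t} \<le> 1/3"
  shows "prob {s \<in> space M. T (100 * k) s < real k * t} \<le> 500 * (1/10) ^ k"
proof -
  define c where "c = 5 * (1000 * (10/11::real) ^ 100) ^ k"
  define B where "B p = {s \<in> space M. path_weight (\<lambda>e. \<omega> e s) p < real k * t}" for p
  define A where "A N = (\<Union>p\<in>paths_to (100 * k) N. B p)" for N
  \<comment> \<open>Growth rate of the paths times the mean factor of an edge, about 0.985.\<close>
  define \<rho> where "\<rho> = (59/20 * (334/1000) :: real)"
  have B: "B p \<in> events" "prob (B p) \<le> 1000 ^ k * (334/1000) ^ N" if "p \<in> paths_to (100 * k) N" for p N
    unfolding B_def using that cheap_path_prob[OF t q] by (auto simp: paths_to_def)
  have Aev: "A N \<in> events" for N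
    unfolding A_def using finite_paths_to B by (intro sets.finite_UN) auto
  have PA: "prob (A N) \<le> c * \<rho> ^ N" for N
  proof -
    have "prob (A N) \<le> (\<Sum>p\<in>paths_to (100 * k) N. prob (B p))"
      unfolding A_def using B by (intro finite_measure_subadditive_finite finite_paths_to) auto
    also have "\<dots> \<le> (\<Sum>p\<in>paths_to (100 * k) N. 1000 ^ k * (334/1000) ^ N)"
      by (intro sum_mono B)
    also have "\<dots> = real (card (paths_to (100 * k) N)) * (1000 ^ k * (334/1000) ^ N)" by simp
    also have "\<dots> \<le> (5 * (59/20) ^ N * (10/11) ^ (100 * k)) * (1000 ^ k * (334/1000) ^ N)"
      by (intro mult_right_mono card_paths_to) auto
    also have "\<dots> = 5 * (1000 ^ k * ((10/11) ^ 100) ^ k) * ((59/20) ^ N * (334/1000) ^ N)"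
      unfolding power_mult by (simp only: mult_ac)
    also have "\<dots> = c * \<rho> ^ N" unfolding c_def \<rho>_def power_mult_distrib ..
    finally show ?thesis .
  qed
  have \<rho>: "0 \<le> \<rho>" "\<rho> < 1" "1 / (1 - \<rho>) \<le> 100" by (simp_all add: \<rho>_def)
  have sm: "summable (\<lambda>N. c * \<rho> ^ N)" using \<rho> by (intro summable_mult summable_geometric) auto
  have smA: "summable (\<lambda>N. prob (A N))"
    by (rule summable_comparison_test'[OF sm, of 0]) (use PA in auto)
  have "prob {s \<in> space M. T (100 * k) s < real k * t} \<le> prob (\<Union>N. A N)"
  proof (rule finite_measure_mono)
    show "{s \<in> space M. T (100 * k) s < real k * t} \<subseteq> (\<Union>N. A N)"
    proof
      fix s assume s: "s \<in> {s \<in> space M. T (100 * k) s < real k * t}"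
      have "path_weight (\<lambda>e. \<omega> e s) ` {p. sa_path p (0, 0) (int (100 * k), 0)} \<noteq> {}"
        using ex_sa_path by blast
      from cInf_lessD[OF this, of "real k * t"] s obtain p where p: "sa_path p (0, 0) (int (100 * k), 0)"
        "path_weight (\<lambda>e. \<omega> e s) p < real k * t" by (auto simp: T_def passage_time_def)
      have "p \<in> paths_to (100 * k) (length p - 1)" using p by (auto simp: paths_to_def sa_path_def)
      moreover have "s \<in> B p" using s p by (simp add: B_def)
      ultimately show "s \<in> (\<Union>N. A N)" unfolding A_def by blast
    qed
  qed (use Aev in auto)
  also have "\<dots> \<le> (\<Sum>N. prob (A N))"
    using Aev smA by (intro finite_measure_subadditive_countably) auto
  also have "\<dots> \<le> (\<Sum>N. c * \<rho> ^ N)" by (rule suminf_le[OF PA smA sm])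
  also have "\<dots> = c * (1 / (1 - \<rho>))" using \<rho> by (simp add: suminf_mult suminf_geometric summable_geometric)
  also have "\<dots> \<le> c * 100" using \<rho> by (intro mult_left_mono) (auto simp: c_def)
  also have "\<dots> = 500 * (1000 * (10/11::real) ^ 100) ^ k" by (simp add: c_def)
  also have "\<dots> \<le> 500 * (1/10) ^ k"
  proof -
    have "1000 * (10/11::real) ^ 100 \<le> 1/10" by (simp add: power_divide)
    then show ?thesis by (intro mult_left_mono power_mono) auto
  qed
  finally show ?thesis .
qed

end

section \<open>Bounds on the time constant\<close>

context fpp
begin

lemma time_constant_upper:
  assumes conv: "\<And>\<epsilon>. \<epsilon> > 0 \<Longrightarrow> (\<lambda>n. prob {s \<in> space M. \<bar>T n s / real n - \<mu>\<bar> > \<epsilon>}) \<longlonglongrightarrow> 0"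
    and t: "0 \<le> t" "2/3 \<le> measure F {..t}"
  shows "\<mu> \<le> 2 * t"
proof (rule ccontr)
  assume neg: "\<not> \<mu> \<le> 2 * t"
  define \<epsilon> where "\<epsilon> = (\<mu> - 2 * t) / 2"
  have \<epsilon>: "\<epsilon> > 0" using neg by (simp add: \<epsilon>_def)
  from order_tendstoD(2)[OF conv[OF \<epsilon>], of "1/16"] obtain N
    where N: "\<And>n. n \<ge> N \<Longrightarrow> prob {s \<in> space M. \<bar>T n s / real n - \<mu>\<bar> > \<epsilon>} < 1/16"
    by (auto simp: eventually_sequentially)
  \<comment> \<open>The successor keeps the divisor \<open>2 * m\<close> positive.\<close>
  define m where "m = Suc N"
  have "1/16 \<le> prob {s \<in> space M. T (2 * m) s \<le> real (4 * m) * t}"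
    by (rule passage_time_upper[OF t])
  also have "\<dots> \<le> prob {s \<in> space M. \<bar>T (2 * m) s / real (2 * m) - \<mu>\<bar> > \<epsilon>}"
  proof (rule finite_measure_mono)
    show "{s \<in> space M. T (2 * m) s \<le> real (4 * m) * t}
        \<subseteq> {s \<in> space M. \<bar>T (2 * m) s / real (2 * m) - \<mu>\<bar> > \<epsilon>}"
    proof safe
      fix s assume "T (2 * m) s \<le> real (4 * m) * t"
      then have "T (2 * m) s / real (2 * m) \<le> 2 * t" by (simp add: m_def field_simps)
      then show "\<epsilon> < \<bar>T (2 * m) s / real (2 * m) - \<mu>\<bar>" using neg by (simp add: \<epsilon>_def)
    qed
  qed measurable
  also have "\<dots> < 1/16" by (rule N) (simp add: m_def)
  finally show False by simp
qed

lemma time_constant_lower: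
  assumes conv: "\<And>\<epsilon>. \<epsilon> > 0 \<Longrightarrow> (\<lambda>n. prob {s \<in> space M. \<bar>T n s / real n - \<mu>\<bar> > \<epsilon>}) \<longlonglongrightarrow> 0"
    and t: "0 < t" "measure F {..t} \<le> 1/3"
  shows "t / 100 \<le> \<mu>"
proof (rule ccontr)
  assume neg: "\<not> t / 100 \<le> \<mu>"
  define \<epsilon> where "\<epsilon> = (t / 100 - \<mu>) / 2"
  have \<epsilon>: "\<epsilon> > 0" using neg by (simp add: \<epsilon>_def)
  from order_tendstoD(2)[OF conv[OF \<epsilon>], of "1/2"] obtain N
    where N: "\<And>n. n \<ge> N \<Longrightarrow> prob {s \<in> space M. \<bar>T n s / real n - \<mu>\<bar> > \<epsilon>} < 1/2"
    by (auto simp: eventually_sequentially)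
  \<comment> \<open>The summand 4 makes the error \<open>500 * (1/10) ^ k\<close> at most
    \<open>1/20\<close>.\<close>
  define k where "k = N + 4"
  let ?A = "{s \<in> space M. \<bar>T (100 * k) s / real (100 * k) - \<mu>\<bar> > \<epsilon>}"
  let ?B = "{s \<in> space M. T (100 * k) s < real k * t}"
  have "space M \<subseteq> ?A \<union> ?B"
  proof
    fix s assume s: "s \<in> space M"
    show "s \<in> ?A \<union> ?B"
    proof (cases "s \<in> ?A")
      case False
      then have "\<bar>T (100 * k) s / real (100 * k) - \<mu>\<bar> \<le> \<epsilon>" using s by simp
      then have "T (100 * k) s / real (100 * k) \<le> \<mu> + \<epsilon>" by (auto dest!: abs_le_D1 simp: algebra_simps)
      also have "\<mu> + \<epsilon> < t / 100" using neg by (simp add: \<epsilon>_def field_simps)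
      finally have "T (100 * k) s / real (100 * k) < t / 100" .
      then show ?thesis using s by (simp add: k_def field_simps)
    qed simp
  qed
  then have "1 \<le> prob (?A \<union> ?B)"
    using finite_measure_mono[of "space M" "?A \<union> ?B"] by (simp add: prob_space)
  also have "\<dots> \<le> prob ?A + prob ?B" by (rule measure_Un_le) measurable
  also have "\<dots> < 1/2 + 500 * (1/10) ^ k"
    using N[of "100 * k"] passage_time_lower[OF t, of k] by (simp add: k_def)
  also have "\<dots> \<le> 1/2 + 500 * (1/10) ^ 4"
    by (intro add_left_mono mult_left_mono power_decreasing) (auto simp: k_def)
  finally show False by (simp add: power_divide)
qed

text \<open>\<open>time_constant_lower\<close> asks for a positive threshold. This bound supplies it
  in the final proof and settles the case of a vanishing quantile.\<close>

lemma time_constant_nonneg: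
  assumes conv: "\<And>\<epsilon>. \<epsilon> > 0 \<Longrightarrow> (\<lambda>n. prob {s \<in> space M. \<bar>T n s / real n - \<mu>\<bar> > \<epsilon>}) \<longlonglongrightarrow> 0"
  shows "0 \<le> \<mu>"
proof (rule ccontr)
  assume neg: "\<not> 0 \<le> \<mu>"
  define \<epsilon> where "\<epsilon> = - \<mu> / 2"
  have \<epsilon>: "\<epsilon> > 0" using neg by (simp add: \<epsilon>_def)
  have "prob {s \<in> space M. \<bar>T n s / real n - \<mu>\<bar> > \<epsilon>} = 1" for n
  proof (rule prob_eq_1[THEN iffD2])
    show "AE s in M. s \<in> {s \<in> space M. \<bar>T n s / real n - \<mu>\<bar> > \<epsilon>}"
      using AE_nonneg AE_space
    proof eventually_elim
      case (elim s)
      have "0 \<le> T n s" unfolding T_def passage_time_def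
        by (rule cINF_greatest) (use elim ex_sa_path path_weight_nonneg in auto)
      then have "0 \<le> T n s / real n" by simp
      then show ?case using elim neg by (simp add: \<epsilon>_def)
    qed
  qed measurable
  then show False using conv[OF \<epsilon>] by (simp add: LIMSEQ_const_iff)
qed

lemma ex_quantile:
  assumes "q < 1"
  shows "{t. t \<ge> 0 \<and> measure F {..t} \<ge> q} \<noteq> {}"
proof -
  interpret F: prob_space F by (rule prob_F)
  have "(\<lambda>n. measure F {..real n}) \<longlonglongrightarrow> measure F (\<Union>n. {..real n})"
    by (rule F.finite_Lim_measure_incseq) (auto simp: sets_F incseq_def)
  moreover have "(\<Union>n. {..real n}) = space F"
    using sets_eq_imp_space_eq[OF sets_F] real_arch_simple by auto
  ultimately have "(\<lambda>n. measure F {..real n}) \<longlonglongrightarrow> 1" by (simp add: F.prob_space)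
  from order_tendstoD(1)[OF this assms] obtain n where "q < measure F {..real n}"
    by (auto simp: eventually_sequentially)
  then show ?thesis by (auto intro!: exI[of _ "real n"])
qed

end

theorem mainTheorem1:
  fixes M :: "'a measure" and F :: "real measure"
    and \<omega> :: "vertex set \<Rightarrow> 'a \<Rightarrow> real" and \<mu> :: real
  assumes "prob_space M"
    and "prob_space F" and "sets F = sets borel" and "measure F {..<0} = 0"
    and "prob_space.indep_vars M (\<lambda>_. borel) \<omega> lattice_edges"
    and "\<forall>e\<in>lattice_edges. distr M borel (\<omega> e) = F"
    and "\<forall>\<epsilon>>0. ((\<lambda>n. measure M {s \<in> space M.
            \<bar>passage_time (\<lambda>e. \<omega> e s) (0, 0) (int n, 0) / real n - \<mu>\<bar> > \<epsilon>})
          \<longlongrightarrow> 0) sequentially"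
  shows "quantile_t F (1/3) / 100 \<le> \<mu> \<and> \<mu> \<le> 2 * quantile_t F (2/3)"
proof -
  interpret fpp M F \<omega>
    using assms by (simp add: fpp_def fpp_axioms_def)
  have conv: "(\<lambda>n. prob {s \<in> space M. \<bar>T n s / real n - \<mu>\<bar> > \<epsilon>}) \<longlonglongrightarrow> 0" if "\<epsilon> > 0" for \<epsilon>
    using assms(7) that by (simp add: T_def)
  have "\<mu> / 2 \<le> quantile_t F (2/3)"
    unfolding quantile_t_def
  proof (rule cInf_greatest)
    show "{t. t \<ge> 0 \<and> measure F {..t} \<ge> 2/3} \<noteq> {}" by (rule ex_quantile) simp
    show "\<mu> / 2 \<le> t" if "t \<in> {t. t \<ge> 0 \<and> measure F {..t} \<ge> 2/3}" for t
      using time_constant_upper[OF conv, of t] that by simp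
  qed
  moreover have "quantile_t F (1/3) / 100 \<le> \<mu>"
  proof (rule ccontr)
    define t where "t = quantile_t F (1/3)"
    assume "\<not> ?thesis"
    then have t: "100 * \<mu> < t" by (simp add: t_def)
    \<comment> \<open>Strictly below the quantile the distribution function is less than 1/3; at the
      quantile itself it may be larger.\<close>
    define s where "s = (100 * \<mu> + t) / 2"
    have s: "0 < s" "100 * \<mu> < s" "s < t" using t time_constant_nonneg[OF conv] by (auto simp: s_def)
    have "\<not> 1/3 \<le> measure F {..s}"
    proof
      assume "1/3 \<le> measure F {..s}"
      then have "t \<le> s" unfolding t_def quantile_t_def
        using s by (intro cInf_lower) (auto intro!: bdd_belowI[of _ 0])
      then show False using s by simp
    qed
    then have "s / 100 \<le> \<mu>" using time_constant_lower[OF conv s(1)] by simp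
    then show False using s by simp
  qed
  ultimately show ?thesis by simp
qed

end
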